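(* Consider the vehicle chain $s^2x_i(s)=u_i(s)+d_i(s)$, $i=0,1,\dots,N$, with configuration errors $e_i(s)=x_{i-1}(s)-x_i(s)$, $i=1,\dots,N$ (time-headway $h=0$), without communication, and with controllers $u_0=0$ and, for $i=1,\dots,N$, $$u_i(s)=K(s)e'_i(s),\qquad e'_i(s)=M^{(r)}(s)x_{i-1}(s)-M^{(f)}(s)x_i(s).$$ There exists no choice of a stabilizing controller $K(s)$ and of sensor transfer functions of the form $$M^{(r)}=\frac{K^{(r)}}{s^2+K^{(r)}},\qquad M^{(f)}=\frac{K^{(f)}}{s^2+K^{(f)}},\qquad K^{(r)}(0)\neq0,\quad K^{(f)}(0)\neq0,$$ for which the chain is $L_2$ string stable, and thus a fortiori none for which it is $(L_2,l_2)$ string stable.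
   Context: Signals are described in the Laplace domain ($s=j\omega$ on the imaginary axis); the system is causal and starts at rest, initial conditions being modeled through the disturbances. $x_i$ is the configuration of vehicle $i$, $u_i$ its control input, $d_i$ a disturbance input; vehicle $0$ is the leader. $e'_i$ is the measured configuration error; $M^{(r)}$ and $M^{(f)}$ model the dynamics of sensor parts mounted on the rear and front ends of the vehicles, where a sensor part at position $p_i$ on vehicle $i$ obeys $s^2p_i=K^{(\cdot)}(s)(x_i-p_i)$. $K(s)$ is a linear controller's transfer function with $K(0)\neq0$ (no cancellation of poles). All transfer functions are independent of $N$ and the same for all vehicles. "Stabilizing" means that the closed-loop vehicle chain, including the sensor dynamics, is stable (no poles in the closed right half plane). Norms: $\Vert v_i(\cdot)\Vert_2=\big(\int_{-\infty}^{+\infty}v_i(t)^2dt\big)^{1/2}$ for a scalar signal, and $\Vert v(\cdot)\Vert_2=\big(\sum_i\int_{-\infty}^{+\infty}v_i(t)^2dt\big)^{1/2}$ for a vector of signals, summing over all components, with $e=(e_1,\dots,e_N)$, $d=(d_0,\dots,d_N)$. $(L_2,l_2)$ string stability: there exists a constant $c_1$ such that $\Vert e(\cdot)\Vert_2\le c_1\Vert d(\cdot)\Vert_2$ for all $d$ of bounded norm and all chain lengths $N$. $L_2$ string stability: there exists a constant $c$ such that $\Vert e_k(\cdot)\Vert_2\le c\,\Vert d_i(\cdot)\Vert_2$ for all $k$, for any situation with a disturbance $d_i$ of bounded norm at some single $i$ and zero disturbances at all other vehicles, and for all $N$. *)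

theory Defs
  imports
    "HOL-Analysis.Analysis"
    "HOL-Computational_Algebra.Computational_Algebra"
    "HOL-Computational_Algebra.Field_as_Ring"
begin

subsection \<open>Transfer functions\<close>

text \<open>
  The transfer function of a (finite-dimensional) linear time-invariant system is an element of the
  field of real rational functions of the Laplace variable. The function \<^const>\<open>quot_of_fract\<close>
  returns its numerator and denominator in lowest terms, so the roots of \<open>tf_den\<close> are exactly the
  poles, and \<open>tf_num\<close> and \<open>tf_den\<close> have no common root.
\<close>

type_synonym transfer_function = "real poly fract"

definition tf_num :: "transfer_function \<Rightarrow> complex poly" where
  "tf_num G = map_poly complex_of_real (fst (quot_of_fract G))"

definition tf_den :: "transfer_function \<Rightarrow> complex poly" where
  "tf_den G = map_poly complex_of_real (snd (quot_of_fract G))"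

definition tf_poles :: "transfer_function \<Rightarrow> complex set" where
  "tf_poles G = {z. poly (tf_den G) z = 0}"

text \<open>Meaningful outside \<open>tf_poles G\<close> only.\<close>

definition tf_eval :: "transfer_function \<Rightarrow> complex \<Rightarrow> complex" where
  "tf_eval G s = poly (tf_num G) s / poly (tf_den G) s"

definition tf_s :: transfer_function where
  "tf_s = Fract [:0, 1:] 1"

definition tf_stable :: "transfer_function \<Rightarrow> bool" where
  "tf_stable G \<longleftrightarrow> (\<forall>z\<in>tf_poles G. Re z < 0)"

definition tf_proper :: "transfer_function \<Rightarrow> bool" where
  "tf_proper G \<longleftrightarrow> degree (tf_num G) \<le> degree (tf_den G)"

definition tf_strictly_proper :: "transfer_function \<Rightarrow> bool" where
  "tf_strictly_proper G \<longleftrightarrow> G = 0 \<or> degree (tf_num G) < degree (tf_den G)"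

text \<open>
  \<open>G(0) \<noteq> 0\<close>, i.e. \<open>G\<close> has no zero at the origin. A pole at the origin (a controller with integral
  action) is allowed.
\<close>

definition tf_nonzero_at_0 :: "transfer_function \<Rightarrow> bool" where
  "tf_nonzero_at_0 G \<longleftrightarrow> poly (tf_num G) 0 \<noteq> 0"

text \<open>
  A sensor part at position \<open>p\<close> on a vehicle at \<open>x\<close> obeys \<open>s\<^sup>2 p = G (x - p)\<close>, that is,
  \<open>p = tf_sensor G * x\<close>.
\<close>

definition tf_sensor :: "transfer_function \<Rightarrow> transfer_function" where
  "tf_sensor G = G / (tf_s\<^sup>2 + G)"


subsection \<open>The vehicle chain\<close>

text \<open>
  The chain equations are stated over an arbitrary field: over the complex numbers they relate the
  values at \<open>s\<close> of Laplace transforms of signals; over the field of rational functions (with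
  \<open>s = tf_s\<close> and a unit disturbance on one vehicle) their solution consists of the closed-loop
  transfer functions.
\<close>

definition config_error :: "(nat \<Rightarrow> 'a::minus) \<Rightarrow> nat \<Rightarrow> 'a" where
  "config_error x i = x (i - 1) - x i"

definition measured_error :: "'a::field \<Rightarrow> 'a \<Rightarrow> (nat \<Rightarrow> 'a) \<Rightarrow> nat \<Rightarrow> 'a" where
  "measured_error Mr Mf x i = Mr * x (i - 1) - Mf * x i"

definition control_input :: "'a::field \<Rightarrow> 'a \<Rightarrow> 'a \<Rightarrow> (nat \<Rightarrow> 'a) \<Rightarrow> nat \<Rightarrow> 'a" where
  "control_input K Mr Mf x i = (if i = 0 then 0 else K * measured_error Mr Mf x i)"

definition chain_equations ::
  "'a::field \<Rightarrow> 'a \<Rightarrow> 'a \<Rightarrow> 'a \<Rightarrow> nat \<Rightarrow> (nat \<Rightarrow> 'a) \<Rightarrow> (nat \<Rightarrow> 'a) \<Rightarrow> bool" where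
  "chain_equations s K Mr Mf N d x \<longleftrightarrow>
     (\<forall>i\<le>N. s\<^sup>2 * x i = control_input K Mr Mf x i + d i)"

text \<open>
  Causality. Not the controller itself but only its series connection with the double integrator
  of a vehicle is required to be strictly proper, so that ideal PD and PID controllers are covered
  as well as proper ones. The sensors are constrained through \<open>Mr\<close> and \<open>Mf\<close>, so that a sensor
  mounted by a spring and an ideal damper is covered.
\<close>

definition causal_chain ::
  "transfer_function \<Rightarrow> transfer_function \<Rightarrow> transfer_function \<Rightarrow> bool" where
  "causal_chain K Mr Mf \<longleftrightarrow> tf_strictly_proper (K / tf_s\<^sup>2) \<and> tf_proper Mr \<and> tf_proper Mf"

text \<open>
  Stability of the closed loop for all chain lengths. The leader is an uncontrolled double
  integrator, so absolute positions cannot be stable; the signals considered are the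
  configuration errors, the control inputs, and the displacements of the sensor parts
  relative to the vehicle that carries them.
\<close>

definition stabilizing ::
  "transfer_function \<Rightarrow> transfer_function \<Rightarrow> transfer_function \<Rightarrow> bool" where
  "stabilizing K Mr Mf \<longleftrightarrow>
     (\<forall>N. \<forall>j\<le>N. \<forall>x.
        chain_equations tf_s K Mr Mf N (\<lambda>i. if i = j then 1 else 0) x \<longrightarrow>
          (\<forall>k\<in>{1..N}. tf_stable (config_error x k)) \<and>
          (\<forall>i\<in>{1..N}. tf_stable (control_input K Mr Mf x i)) \<and>
          (\<forall>i\<in>{0..N}. tf_stable (x i - Mr * x i)) \<and>
          (\<forall>i\<in>{1..N}. tf_stable (x i - Mf * x i)))"


subsection \<open>Signals\<close>

text \<open>
  Signals vanish for negative time (the system starts at rest at time 0) and are of at most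
  exponential growth in the integral sense, so that their Laplace transform exists in some
  right half plane.
\<close>

definition laplace_signal :: "(real \<Rightarrow> real) \<Rightarrow> bool" where
  "laplace_signal v \<longleftrightarrow>
     (\<forall>t<0. v t = 0) \<and> (\<exists>\<sigma>. set_integrable lborel {0..} (\<lambda>t. exp (- \<sigma> * t) * v t))"

definition laplace :: "(real \<Rightarrow> real) \<Rightarrow> complex \<Rightarrow> complex" where
  "laplace v s = (LINT t:{0..}|lborel. exp (- s * of_real t) * of_real (v t))"

definition bounded_norm :: "(real \<Rightarrow> real) \<Rightarrow> bool" where
  "bounded_norm v \<longleftrightarrow> v \<in> borel_measurable lborel \<and> integrable lborel (\<lambda>t. (v t)\<^sup>2)"

definition L2_norm :: "(real \<Rightarrow> real) \<Rightarrow> real" where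
  "L2_norm v = sqrt (LINT t|lborel. (v t)\<^sup>2)"

definition L2_l2_norm :: "nat set \<Rightarrow> (nat \<Rightarrow> real \<Rightarrow> real) \<Rightarrow> real" where
  "L2_l2_norm I v = sqrt (\<Sum>i\<in>I. LINT t|lborel. (v i t)\<^sup>2)"

text \<open>
  The time signals \<open>x 0, \<dots>, x N\<close> are the response of the chain of length \<open>N\<close> to the disturbances
  \<open>d 0, \<dots>, d N\<close>: their Laplace transforms satisfy the chain equations in some right half plane.
\<close>

definition chain_response ::
  "transfer_function \<Rightarrow> transfer_function \<Rightarrow> transfer_function \<Rightarrow> nat \<Rightarrow>
     (nat \<Rightarrow> real \<Rightarrow> real) \<Rightarrow> (nat \<Rightarrow> real \<Rightarrow> real) \<Rightarrow> bool" where
  "chain_response K Mr Mf N d x \<longleftrightarrow>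
     (\<forall>i\<le>N. laplace_signal (d i) \<and> laplace_signal (x i)) \<and>
     (\<exists>\<sigma>. \<forall>s. Re s > \<sigma> \<longrightarrow>
        chain_equations s (tf_eval K s) (tf_eval Mr s) (tf_eval Mf s) N
          (\<lambda>i. laplace (d i) s) (\<lambda>i. laplace (x i) s))"

definition error_signal :: "(nat \<Rightarrow> real \<Rightarrow> real) \<Rightarrow> nat \<Rightarrow> real \<Rightarrow> real" where
  "error_signal x k = (\<lambda>t. config_error (\<lambda>i. x i t) k)"


subsection \<open>String stability\<close>

definition L2_l2_string_stable ::
  "transfer_function \<Rightarrow> transfer_function \<Rightarrow> transfer_function \<Rightarrow> bool" where
  "L2_l2_string_stable K Mr Mf \<longleftrightarrow>
     (\<exists>c. \<forall>N d x.
        chain_response K Mr Mf N d x \<and> (\<forall>i\<le>N. bounded_norm (d i)) \<longrightarrow>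
          (\<forall>k\<in>{1..N}. bounded_norm (error_signal x k)) \<and>
          L2_l2_norm {1..N} (error_signal x) \<le> c * L2_l2_norm {0..N} d)"

definition L2_string_stable ::
  "transfer_function \<Rightarrow> transfer_function \<Rightarrow> transfer_function \<Rightarrow> bool" where
  "L2_string_stable K Mr Mf \<longleftrightarrow>
     (\<exists>c. \<forall>N d x. \<forall>i\<le>N.
        chain_response K Mr Mf N d x \<and> bounded_norm (d i) \<and>
        (\<forall>j\<le>N. j \<noteq> i \<longrightarrow> d j = (\<lambda>t. 0)) \<longrightarrow>
          (\<forall>k\<in>{1..N}. bounded_norm (error_signal x k) \<and>
             L2_norm (error_signal x k) \<le> c * L2_norm (d i)))"

end

theory Submission
  imports Defs "HOL-Probability.Sinc_Integral" "HOL-Real_Asymp.Real_Asymp"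
begin

text \<open>
  A disturbance \<open>d\<close> on the leader yields the errors \<open>e\<^sub>k = H\<^sup>k\<^sup>-\<^sup>1 (1 - H) d / s\<^sup>2\<close>, where
  \<open>H = K M\<^sub>r / (s\<^sup>2 + K M\<^sub>f)\<close>. As \<open>K\<close>, \<open>K\<^sub>r\<close> and \<open>K\<^sub>f\<close> do not vanish at \<open>0\<close>, the double integrator
  forces \<open>H = 1 + O(s\<^sup>2)\<close> at \<open>0\<close>, and \<open>H\<close> is not constant because it tends to \<open>0\<close> at infinity.
  Hence \<open>H = 1 + c s\<^sup>m + \<dots>\<close> with \<open>c \<noteq> 0\<close> and \<open>m \<ge> 2\<close>; as \<open>s\<close> runs through the right half plane,
  the argument of \<open>s\<^sup>m\<close> covers an interval of length at least \<open>2 \<pi>\<close>, so some \<open>s\<close> with \<open>Re s > 0\<close>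
  has \<open>|H(s)| > 1\<close>. At this \<open>s\<close> the transforms of the errors grow geometrically in \<open>k\<close>, whereas
  evaluation of the Laplace transform at a point of the right half plane is bounded in terms of the
  \<open>L\<^sub>2\<close> norm.

  Since string stability quantifies over time signals, the responses have to be exhibited as
  inverse Laplace transforms of rational functions, which partial fractions provide. The errors are
  inverted first, and the positions defined as \<open>x\<^sub>k = x\<^sub>0 - e\<^sub>1 - \<dots> - e\<^sub>k\<close>: in this way stability of
  the chain gives the transform of each error on the whole right half plane, without analytic
  continuation.
\<close>

subsection \<open>Evaluation of transfer functions\<close>

lemma poly_map_poly_of_real_add:
  "poly (map_poly complex_of_real (p + q)) s
     = poly (map_poly complex_of_real p) s + poly (map_poly complex_of_real q) s"
proof -
  have "map_poly complex_of_real (p + q) = map_poly complex_of_real p + map_poly complex_of_real q"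
    by (rule poly_eqI) (simp add: coeff_map_poly)
  then show ?thesis
    by simp
qed

lemma poly_map_poly_of_real_mult:
  "poly (map_poly complex_of_real (p * q)) s
     = poly (map_poly complex_of_real p) s * poly (map_poly complex_of_real q) s"
proof -
  have "map_poly complex_of_real (p * q) = map_poly complex_of_real p * map_poly complex_of_real q"
    by (rule poly_eqI) (simp add: coeff_map_poly coeff_mult)
  then show ?thesis
    by simp
qed

lemma poly_map_poly_of_real_cnj:
  "poly (map_poly complex_of_real p) (cnj s) = cnj (poly (map_poly complex_of_real p) s)"
  by (induction p) (simp_all add: map_poly_pCons)

lemma tf_den_nonzero [simp]: "tf_den G \<noteq> 0"
  by (simp add: tf_den_def map_poly_eq_0_iff)

lemma tf_num_eq_0_iff: "tf_num G = 0 \<longleftrightarrow> G = 0"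
  by (simp add: tf_num_def map_poly_eq_0_iff)

lemma finite_tf_poles: "finite (tf_poles G)"
  unfolding tf_poles_def by (rule poly_roots_finite) simp

text \<open>Coprimality holds over the real polynomials, but the Bezout identity it provides can be
  evaluated at complex points as well, and there it excludes a common root.\<close>

lemma tf_num_den_no_common_root:
  assumes "poly (tf_num G) s = 0" "poly (tf_den G) s = 0"
  shows False
proof -
  have "coprime (fst (quot_of_fract G)) (snd (quot_of_fract G))"
    by (rule coprime_quot_of_fract)
  then obtain u v where "u * fst (quot_of_fract G) + v * snd (quot_of_fract G) = 1"
    using bezout_coefficients_fst_snd[of "fst (quot_of_fract G)" "snd (quot_of_fract G)"]
    by (metis coprime_imp_gcd_eq_1)
  then have "poly (map_poly complex_of_real
      (u * fst (quot_of_fract G) + v * snd (quot_of_fract G))) s = 1"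
    by simp
  then show False
    using assms
    by (simp add: poly_map_poly_of_real_add poly_map_poly_of_real_mult tf_num_def tf_den_def)
qed

text \<open>Cross-multiplying with the reduced fraction \<open>a / b\<close> shows that a root of
  \<open>b\<close> at \<open>s\<close> would also be a root of \<open>a\<close>. So values can be
  read off any fraction whose denominator does not vanish at \<open>s\<close>, without reducing
  it.\<close>

lemma tf_Fract:
  assumes "poly (map_poly complex_of_real q) s \<noteq> 0"
  shows "s \<notin> tf_poles (Fract p q)"
    and "tf_eval (Fract p q) s
           = poly (map_poly complex_of_real p) s / poly (map_poly complex_of_real q) s"
proof -
  let ?c = "\<lambda>p. poly (map_poly complex_of_real p) s"
  define a b where "a = fst (quot_of_fract (Fract p q))" and "b = snd (quot_of_fract (Fract p q))"
  have "q \<noteq> 0"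
    using assms by auto
  moreover have "b \<noteq> 0" "Fract a b = Fract p q"
    by (simp_all add: a_def b_def)
  ultimately have "a * q = p * b"
    by (simp add: eq_fract)
  then have eq: "?c a * ?c q = ?c p * ?c b"
    by (metis poly_map_poly_of_real_mult)
  have ab: "?c a = poly (tf_num (Fract p q)) s" "?c b = poly (tf_den (Fract p q)) s"
    by (simp_all add: a_def b_def tf_num_def tf_den_def)
  have "?c b \<noteq> 0"
  proof
    assume "?c b = 0"
    with eq assms have "?c a = 0"
      by simp
    with \<open>?c b = 0\<close> show False
      using tf_num_den_no_common_root[of "Fract p q" s] ab by simp
  qed
  then show "s \<notin> tf_poles (Fract p q)"
    by (simp add: tf_poles_def ab)
  show "tf_eval (Fract p q) s = ?c p / ?c q"
    using eq assms \<open>?c b \<noteq> 0\<close> by (simp add: tf_eval_def ab[symmetric] field_simps)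
qed

lemma tf_cases_at:
  assumes "s \<notin> tf_poles G"
  obtains p q where "G = Fract p q" "poly (map_poly complex_of_real q) s \<noteq> 0"
  using assms that[of "fst (quot_of_fract G)" "snd (quot_of_fract G)"]
  by (simp add: tf_poles_def tf_den_def)

text \<open>Evaluation respects the field operations only off the poles: at a pole
  \<open>tf_eval\<close> takes the default value of a division by zero. Hence the pole conditions in
  the rules for arithmetic.\<close>

lemma tf_add:
  assumes "s \<notin> tf_poles F" "s \<notin> tf_poles G"
  shows "s \<notin> tf_poles (F + G)" "tf_eval (F + G) s = tf_eval F s + tf_eval G s"
proof -
  obtain p q where F: "F = Fract p q" "poly (map_poly complex_of_real q) s \<noteq> 0"
    using tf_cases_at[OF assms(1)] .
  obtain a b where G: "G = Fract a b" "poly (map_poly complex_of_real b) s \<noteq> 0"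
    using tf_cases_at[OF assms(2)] .
  have "q \<noteq> 0" "b \<noteq> 0"
    using F G by auto
  then have FG: "F + G = Fract (p * b + a * q) (q * b)"
    by (simp add: F G)
  have nz: "poly (map_poly complex_of_real (q * b)) s \<noteq> 0"
    using F G by (simp add: poly_map_poly_of_real_mult)
  show "s \<notin> tf_poles (F + G)"
    unfolding FG by (rule tf_Fract(1)[OF nz])
  show "tf_eval (F + G) s = tf_eval F s + tf_eval G s"
    unfolding FG tf_Fract(2)[OF nz] unfolding F(1) G(1) tf_Fract(2)[OF F(2)] tf_Fract(2)[OF G(2)]
    using F(2) G(2)
    by (simp add: poly_map_poly_of_real_mult poly_map_poly_of_real_add add_frac_eq)
qed

lemma tf_mult:
  assumes "s \<notin> tf_poles F" "s \<notin> tf_poles G"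
  shows "s \<notin> tf_poles (F * G)" "tf_eval (F * G) s = tf_eval F s * tf_eval G s"
proof -
  obtain p q where F: "F = Fract p q" "poly (map_poly complex_of_real q) s \<noteq> 0"
    using tf_cases_at[OF assms(1)] .
  obtain a b where G: "G = Fract a b" "poly (map_poly complex_of_real b) s \<noteq> 0"
    using tf_cases_at[OF assms(2)] .
  have FG: "F * G = Fract (p * a) (q * b)"
    by (simp add: F G)
  have nz: "poly (map_poly complex_of_real (q * b)) s \<noteq> 0"
    using F G by (simp add: poly_map_poly_of_real_mult)
  show "s \<notin> tf_poles (F * G)"
    unfolding FG by (rule tf_Fract(1)[OF nz])
  show "tf_eval (F * G) s = tf_eval F s * tf_eval G s"
    unfolding FG tf_Fract(2)[OF nz] unfolding F(1) G(1) tf_Fract(2)[OF F(2)] tf_Fract(2)[OF G(2)]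
    by (simp add: poly_map_poly_of_real_mult)
qed

lemma tf_inverse:
  assumes "s \<notin> tf_poles G" "tf_eval G s \<noteq> 0"
  shows "s \<notin> tf_poles (inverse G)" "tf_eval (inverse G) s = inverse (tf_eval G s)"
proof -
  obtain p q where G: "G = Fract p q" "poly (map_poly complex_of_real q) s \<noteq> 0"
    using tf_cases_at[OF assms(1)] .
  have inv: "inverse G = Fract q p"
    by (simp add: G)
  have nz: "poly (map_poly complex_of_real p) s \<noteq> 0"
    using assms(2) G(2) unfolding G(1) tf_Fract(2)[OF G(2)] by simp
  show "s \<notin> tf_poles (inverse G)"
    unfolding inv by (rule tf_Fract(1)[OF nz])
  show "tf_eval (inverse G) s = inverse (tf_eval G s)"
    unfolding inv tf_Fract(2)[OF nz] unfolding G(1) tf_Fract(2)[OF G(2)] by simp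
qed

lemma tf_const:
  shows "s \<notin> tf_poles (Fract [:c:] 1)" "tf_eval (Fract [:c:] 1) s = of_real c"
  using tf_Fract[of 1 s "[:c:]"] by (simp_all add: map_poly_pCons)

lemma tf_0: "s \<notin> tf_poles 0" "tf_eval 0 s = 0"
  using tf_const[where s = s and c = 0] by (simp_all add: Zero_fract_def)

lemma tf_1: "s \<notin> tf_poles 1" "tf_eval 1 s = 1"
  using tf_const[where s = s and c = 1] by (simp_all add: One_fract_def one_pCons)

lemma tf_s: "s \<notin> tf_poles tf_s" "tf_eval tf_s s = s"
  using tf_Fract[of 1 s "[:0, 1:]"] by (simp_all add: tf_s_def map_poly_pCons)

lemma tf_uminus:
  assumes "s \<notin> tf_poles G"
  shows "s \<notin> tf_poles (- G)" "tf_eval (- G) s = - tf_eval G s"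
proof -
  have m1: "Fract [:-1:] 1 = (-1 :: transfer_function)"
    by (simp add: One_fract_def one_pCons)
  have "- G = Fract [:-1:] 1 * G"
    unfolding m1 by simp
  then show "s \<notin> tf_poles (- G)" "tf_eval (- G) s = - tf_eval G s"
    using tf_mult[OF tf_const(1)[where s = s and c = "-1"] assms] by (simp_all add: tf_const)
qed

lemma tf_diff:
  assumes "s \<notin> tf_poles F" "s \<notin> tf_poles G"
  shows "s \<notin> tf_poles (F - G)" "tf_eval (F - G) s = tf_eval F s - tf_eval G s"
  using tf_add[OF assms(1) tf_uminus(1)[OF assms(2)]] tf_uminus[OF assms(2)] by simp_all

lemma tf_divide:
  assumes "s \<notin> tf_poles F" "s \<notin> tf_poles G" "tf_eval G s \<noteq> 0"
  shows "s \<notin> tf_poles (F / G)" "tf_eval (F / G) s = tf_eval F s / tf_eval G s"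
  using tf_mult[OF assms(1) tf_inverse(1)[OF assms(2,3)]] tf_inverse[OF assms(2,3)]
  by (simp_all add: field_simps)

lemma tf_power:
  assumes "s \<notin> tf_poles G"
  shows "s \<notin> tf_poles (G ^ n)" "tf_eval (G ^ n) s = tf_eval G s ^ n"
proof -
  have "s \<notin> tf_poles (G ^ n) \<and> tf_eval (G ^ n) s = tf_eval G s ^ n"
    using assms by (induction n) (simp_all add: tf_1 tf_mult)
  then show "s \<notin> tf_poles (G ^ n)" "tf_eval (G ^ n) s = tf_eval G s ^ n"
    by simp_all
qed

text \<open>The coefficients are real. This symmetry later yields real-valued inverse
  transforms.\<close>

lemma tf_eval_cnj: "tf_eval G (cnj s) = cnj (tf_eval G s)"
  by (simp add: tf_eval_def tf_num_def tf_den_def poly_map_poly_of_real_cnj)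

lemma continuous_tf_eval:
  assumes "s \<notin> tf_poles G"
  shows "isCont (tf_eval G) s"
  using assms unfolding tf_eval_def[abs_def] tf_poles_def by (intro continuous_intros) simp

lemma tf_stable_mult: "tf_stable F \<Longrightarrow> tf_stable G \<Longrightarrow> tf_stable (F * G)"
  unfolding tf_stable_def using tf_mult(1) by blast


subsection \<open>Behaviour at infinity\<close>

lemma eventually_at_infinity_notin_finite:
  fixes A :: "'a::real_normed_vector set"
  assumes "finite A"
  shows "\<forall>\<^sub>F x in at_infinity. x \<notin> A"
proof -
  obtain B where "\<And>x. x \<in> A \<Longrightarrow> norm x \<le> B"
    using finite_imp_bounded[OF assms] by (auto simp: bounded_iff)
  then show ?thesis
    by (intro eventually_at_infinityI[of "B + 1"]) force
qed

lemma eventually_poly_nonzero_at_infinity: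
  fixes p :: "complex poly"
  assumes "p \<noteq> 0"
  shows "\<forall>\<^sub>F s in at_infinity. poly p s \<noteq> 0"
  using eventually_at_infinity_notin_finite[OF poly_roots_finite[OF assms]] by simp

lemma tendsto_poly_quotient_at_infinity:
  fixes p q :: "complex poly"
  assumes "degree p \<le> degree q" "q \<noteq> 0"
  shows "\<exists>L. ((\<lambda>s. poly p s / poly q s) \<longlongrightarrow> L) at_infinity"
proof (cases "degree p = degree q")
  case True
  have cancel: "(a / c) / (b / c) = a / b" if "c \<noteq> 0" for a b c :: complex
    using that by simp
  have "((\<lambda>s. (poly p s / s ^ degree p) / (poly q s / s ^ degree q))
           \<longlongrightarrow> lead_coeff p / lead_coeff q) at_infinity"
    using assms by (intro tendsto_divide poly_divide_tendsto_aux) auto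
  moreover have "\<forall>\<^sub>F s::complex in at_infinity. s \<noteq> 0"
    using eventually_poly_nonzero_at_infinity[of "[:0, 1:]"] by simp
  then have "\<forall>\<^sub>F s in at_infinity. (poly p s / s ^ degree p) / (poly q s / s ^ degree q)
               = poly p s / poly q s"
    unfolding True by eventually_elim (rule cancel, simp)
  ultimately have "((\<lambda>s. poly p s / poly q s) \<longlongrightarrow> lead_coeff p / lead_coeff q) at_infinity"
    by (rule Lim_transform_eventually)
  then show ?thesis
    by blast
next
  case False
  then show ?thesis
    using poly_divide_tendsto_0_at_infinity[of p q] assms by auto
qed

lemma tf_proper_tendsto:
  assumes "tf_proper G"
  shows "\<exists>L. (tf_eval G \<longlongrightarrow> L) at_infinity"
  using tendsto_poly_quotient_at_infinity[of "tf_num G" "tf_den G"] assms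
  unfolding tf_eval_def[abs_def] tf_proper_def by simp

lemma eventually_not_tf_poles: "\<forall>\<^sub>F s in at_infinity. s \<notin> tf_poles G"
  by (rule eventually_at_infinity_notin_finite[OF finite_tf_poles])

text \<open>Turns a degree condition on reduced fractions into a limit, which is compatible with
  products and quotients. For the converse, if the degrees were the other way round, the reciprocal
  quotient would have a finite limit, and its product with \<open>tf_eval G\<close>, eventually 1,
  would tend to 0.\<close>

lemma tf_strictly_proper_iff_tendsto_0:
  "tf_strictly_proper G \<longleftrightarrow> (tf_eval G \<longlongrightarrow> 0) at_infinity"
proof
  assume "tf_strictly_proper G"
  then show "(tf_eval G \<longlongrightarrow> 0) at_infinity"
    unfolding tf_strictly_proper_def
  proof
    assume "G = 0"
    then show ?thesis
      by (simp add: tf_0(2)[abs_def])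
  next
    assume "degree (tf_num G) < degree (tf_den G)"
    then show ?thesis
      unfolding tf_eval_def[abs_def] by (rule poly_divide_tendsto_0_at_infinity)
  qed
next
  assume lim: "(tf_eval G \<longlongrightarrow> 0) at_infinity"
  show "tf_strictly_proper G"
  proof (rule ccontr)
    assume "\<not> tf_strictly_proper G"
    then have deg: "degree (tf_den G) \<le> degree (tf_num G)" and nz: "tf_num G \<noteq> 0"
      by (simp_all add: tf_strictly_proper_def tf_num_eq_0_iff)
    obtain L where "((\<lambda>s. poly (tf_den G) s / poly (tf_num G) s) \<longlongrightarrow> L) at_infinity"
      using tendsto_poly_quotient_at_infinity[OF deg nz] by blast
    from tendsto_mult[OF this lim]
    have "((\<lambda>s. poly (tf_den G) s / poly (tf_num G) s * tf_eval G s) \<longlongrightarrow> 0) at_infinity"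
      by simp
    moreover have "\<forall>\<^sub>F s in at_infinity. poly (tf_den G) s / poly (tf_num G) s * tf_eval G s = 1"
      using eventually_poly_nonzero_at_infinity[OF nz] eventually_poly_nonzero_at_infinity[OF tf_den_nonzero[of G]]
      by eventually_elim (simp add: tf_eval_def)
    ultimately have "((\<lambda>s::complex. 1::complex) \<longlongrightarrow> 0) at_infinity"
      by (rule Lim_transform_eventually)
    moreover have "((\<lambda>s::complex. 1::complex) \<longlongrightarrow> 1) at_infinity"
      by simp
    moreover have "(at_infinity :: complex filter) \<noteq> bot"
      by (simp add: trivial_limit_at_infinity)
    ultimately show False
      using tendsto_unique[of "at_infinity :: complex filter" "\<lambda>_. 1" 0 "1::complex"] by simp
  qed
qed

lemma tendsto_tf_eval_mult:
  assumes "(tf_eval F \<longlongrightarrow> a) at_infinity" "(tf_eval G \<longlongrightarrow> b) at_infinity"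
  shows "(tf_eval (F * G) \<longlongrightarrow> a * b) at_infinity"
proof (rule Lim_transform_eventually[OF tendsto_mult[OF assms]])
  show "\<forall>\<^sub>F s in at_infinity. tf_eval F s * tf_eval G s = tf_eval (F * G) s"
    using eventually_not_tf_poles[of F] eventually_not_tf_poles[of G]
    by eventually_elim (simp add: tf_mult)
qed

lemma tendsto_tf_eval_inverse_s_squared: "(tf_eval (inverse (tf_s\<^sup>2)) \<longlongrightarrow> 0) at_infinity"
proof (rule Lim_transform_eventually)
  have "((\<lambda>s::complex. inverse s ^ 2) \<longlongrightarrow> 0 ^ 2) at_infinity"
    by (intro tendsto_power tendsto_inverse_0)
  then show "((\<lambda>s::complex. inverse s ^ 2) \<longlongrightarrow> 0) at_infinity"
    by simp
  have "\<forall>\<^sub>F s::complex in at_infinity. s \<notin> {0}"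
    by (rule eventually_at_infinity_notin_finite) simp
  then show "\<forall>\<^sub>F s in at_infinity. inverse s ^ 2 = tf_eval (inverse (tf_s\<^sup>2)) s"
    by eventually_elim (simp add: tf_inverse tf_power tf_s power_inverse)
qed


subsection \<open>Laplace transforms and their inversion\<close>

lemma set_integrable_power_exp:
  assumes "0 < u"
  shows "set_integrable lborel {0..} (\<lambda>t::real. t ^ n * exp (- u * t))"
proof -
  have "integrable lborel (\<lambda>x::real. x ^ n * exp (- x) * indicator {0..} x)"
    using has_bochner_integral_I0i_power_exp_m'[of n] by (rule integrable.intros)
  \<comment> \<open>The substitution of \<open>u * x\<close> for \<open>x\<close> carries the case
    \<open>u = 1\<close> to the general one, up to the factor \<open>u ^ n\<close>.\<close>
  then have "integrable lborel (\<lambda>x. (u * x) ^ n * exp (- (u * x)) * indicator {0..} (u * x))"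
    using lborel_integrable_real_affine_iff[of u "\<lambda>x. x ^ n * exp (- x) * indicator {0..} x" 0] assms
    by simp
  then have "integrable lborel
      (\<lambda>x. inverse (u ^ n) * ((u * x) ^ n * exp (- (u * x)) * indicator {0..} (u * x)))"
    by simp
  moreover have "inverse (u ^ n) * ((u * x) ^ n * exp (- (u * x)) * indicator {0..} (u * x))
      = indicator {0..} x *\<^sub>R (x ^ n * exp (- u * x))" for x
    using assms by (auto simp: indicator_def zero_le_mult_iff power_mult_distrib)
  ultimately show ?thesis
    unfolding set_integrable_def by simp
qed

lemma set_integrable_power_exp_complex:
  assumes "0 < Re z"
  shows "set_integrable lborel {0..} (\<lambda>t. of_real t ^ n * exp (- z * of_real t))"
proof (rule set_integrable_bound[OF set_integrable_power_exp[OF assms, of n]])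
  show "set_borel_measurable lborel {0..} (\<lambda>t. of_real t ^ n * exp (- z * of_real t))"
    unfolding set_borel_measurable_def by measurable
qed (auto simp: norm_mult norm_power)


text \<open>Integration by parts gives the recursion \<open>J (Suc n) = Suc n * J n / z\<close>; the
  only nonzero boundary value is the one at 0 for exponent 0.\<close>

lemma set_integral_power_exp:
  assumes "0 < Re z"
  shows "(LINT t:{0..}|lborel. of_real t ^ n * exp (- z * of_real t)) = fact n / z ^ Suc n"
proof -
  \<comment> \<open>The fundamental theorem for interval integrals works on the open half line; the
    end point is restored at the end as a null set.\<close>
  define J where "J n = (LINT t:{0<..}|lborel. of_real t ^ n * exp (- z * of_real t))" for n
  have int: "set_integrable lborel {0<..} (\<lambda>t. of_real t ^ n * exp (- z * of_real t))" for n
    by (rule set_integrable_subset[OF set_integrable_power_exp_complex[OF assms]]) auto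
  have lim: "((\<lambda>t. of_real t ^ n * exp (- z * of_real t)) \<longlongrightarrow> 0) at_top" for n
  proof (rule tendsto_norm_zero_cancel)
    have "((\<lambda>t. t ^ n * exp (- Re z * t)) \<longlongrightarrow> 0) at_top"
      using assms by real_asymp
    moreover have "\<forall>\<^sub>F t in at_top. t ^ n * exp (- Re z * t) = norm (of_real t ^ n * exp (- z * of_real t))"
      using eventually_ge_at_top[of 0] by eventually_elim (simp add: norm_mult norm_power)
    ultimately show "((\<lambda>t. norm (of_real t ^ n * exp (- z * of_real t))) \<longlongrightarrow> 0) at_top"
      by (rule Lim_transform_eventually)
  qed
  have ftc: "(LINT t:{0<..}|lborel. F' t) = - F 0"
    if "\<And>t. (F has_vector_derivative F' t) (at t)" "\<And>t. isCont F' t"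
      "set_integrable lborel {0<..} F'" "(F \<longlongrightarrow> 0) at_top" for F F' :: "real \<Rightarrow> complex"
  proof -
    have "isCont F 0"
      using that(1) has_vector_derivative_continuous by blast
    then have "(F \<longlongrightarrow> F 0) (at_right 0)"
      by (simp add: continuous_at_imp_continuous_at_within continuous_within[symmetric])
    then have "(LBINT t=ereal 0..\<infinity>. F' t) = 0 - F 0"
      using that by (intro interval_integral_FTC_integrable) (auto simp: ereal_tendsto_simps)
    then show ?thesis
      by (simp add: interval_integral_to_infinity_eq)
  qed
  \<comment> \<open>For \<open>n = 0\<close> the truncated exponent \<open>n - 1\<close> does no
    harm, since the factor \<open>of_nat n\<close> vanishes.\<close>
  have der: "((\<lambda>t. of_real t ^ n * exp (- z * of_real t)) has_vector_derivative
      (of_nat n * of_real t ^ (n - 1) * exp (- z * of_real t)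
         - z * (of_real t ^ n * exp (- z * of_real t)))) (at t)" for n t
  proof -
    have "((\<lambda>w. w ^ n * exp (- z * w)) has_field_derivative
      (of_nat n * of_real t ^ (n - 1) * exp (- z * of_real t)
         - z * (of_real t ^ n * exp (- z * of_real t)))) (at (of_real t))"
      by (auto intro!: derivative_eq_intros simp: algebra_simps)
    from has_vector_derivative_real_field[OF this] show ?thesis
      by simp
  qed
  have "J n = fact n / z ^ Suc n"
  proof (induction n)
    case 0
    have "(LINT t:{0<..}|lborel. - z * (of_real t ^ 0 * exp (- z * of_real t))) = - 1"
    proof -
      have "(LINT t:{0<..}|lborel. - z * (of_real t ^ 0 * exp (- z * of_real t)))
          = - (of_real 0 ^ 0 * exp (- z * of_real 0))"
      proof (rule ftc[OF _ _ _ lim[of 0]])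
        show "((\<lambda>t. of_real t ^ 0 * exp (- z * of_real t)) has_vector_derivative
            - z * (of_real t ^ 0 * exp (- z * of_real t))) (at t)" for t
          using der[of 0 t] by simp
        show "set_integrable lborel {0<..} (\<lambda>t. - z * (of_real t ^ 0 * exp (- z * of_real t)))"
          using int[of 0] by (rule set_integrable_mult_right)
      qed (intro continuous_intros)
      then show ?thesis
        by simp
    qed
    moreover have "(LINT t:{0<..}|lborel. - z * (of_real t ^ 0 * exp (- z * of_real t))) = - z * J 0"
      unfolding J_def by (rule set_integral_mult_right)
    moreover have "z \<noteq> 0"
      using assms by auto
    ultimately show ?case
      by (simp add: field_simps)
  next
    case (Suc n)
    let ?F = "\<lambda>n t. of_real t ^ n * exp (- z * of_real t)"
    have "(LINT t:{0<..}|lborel. of_nat (Suc n) * ?F n t - z * ?F (Suc n) t) = 0"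
    proof -
      have "(LINT t:{0<..}|lborel. of_nat (Suc n) * ?F n t - z * ?F (Suc n) t) = - ?F (Suc n) 0"
      proof (rule ftc[OF _ _ _ lim[of "Suc n"]])
        show "(?F (Suc n) has_vector_derivative of_nat (Suc n) * ?F n t - z * ?F (Suc n) t) (at t)"
          for t
          using der[of "Suc n" t] by (simp add: mult.assoc)
        show "set_integrable lborel {0<..} (\<lambda>t. of_nat (Suc n) * ?F n t - z * ?F (Suc n) t)"
          by (intro set_integral_diff(1) set_integrable_mult_right int)
      qed (intro continuous_intros)
      then show ?thesis
        by simp
    qed
    moreover have "(LINT t:{0<..}|lborel. of_nat (Suc n) * ?F n t - z * ?F (Suc n) t)
        = of_nat (Suc n) * J n - z * J (Suc n)"
      unfolding J_def using int[of n] int[of "Suc n"]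
      by (subst set_integral_diff(2)) auto
    moreover have "z \<noteq> 0"
      using assms by auto
    ultimately have "J (Suc n) = of_nat (Suc n) * J n / z"
      by (simp add: field_simps)
    then show ?case
      using Suc by simp
  qed
  moreover have "(LINT t:{0..}|lborel. of_real t ^ n * exp (- z * of_real t)) = J n"
    unfolding J_def
  proof (rule set_integral_cong_set)
    show "AE t in lborel. (t \<in> {0<..}) = (t \<in> {0::real..})"
      using AE_lborel_singleton[of "0::real"] by eventually_elim auto
  qed (auto simp: set_borel_measurable_def)
  ultimately show ?thesis
    by simp
qed

text \<open>Partial fractions, one term at a time: at a root \<open>p\<close> of \<open>Q\<close> of
  multiplicity \<open>Suc m\<close> the term \<open>c / (s - p) ^ Suc m\<close> is split off, with
  inverse transform \<open>c / fact m * t ^ m * exp (p * t)\<close>. The remainder has the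
  denominator \<open>Q / (s - p)\<close>, to which the induction hypothesis applies.\<close>

lemma inverse_laplace_rational:
  fixes P Q :: "complex poly"
  assumes "Q \<noteq> 0" "P = 0 \<or> degree P < degree Q"
  shows "\<exists>g. \<forall>s. (\<forall>z. poly Q z = 0 \<longrightarrow> Re z < Re s) \<longrightarrow>
           set_integrable lborel {0..} (\<lambda>t. exp (- s * of_real t) * g t) \<and>
           (LINT t:{0..}|lborel. exp (- s * of_real t) * g t) = poly P s / poly Q s"
  using assms
proof (induction "degree Q" arbitrary: P Q rule: less_induct)
  case less
  show ?case
  proof (cases "degree Q = 0")
    case True
    then have "P = 0"
      using less.prems by simp
    then show ?thesis
      by (intro exI[of _ "\<lambda>_. 0"]) (simp add: set_integrable_def set_lebesgue_integral_def)
  next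
    case False
    then obtain p where p: "poly Q p = 0"
      using fundamental_theorem_of_algebra[of Q] constant_degree[of Q] by auto
    obtain Q2 where Q2: "Q = [:- p, 1:] ^ order p Q * Q2" "\<not> [:- p, 1:] dvd Q2"
      using order_decomp[OF less.prems(1), of p] by blast
    have "order p Q \<noteq> 0"
      using p less.prems(1) by (simp add: order_root)
    then obtain m where m: "order p Q = Suc m"
      using not0_implies_Suc by blast
    have Q2p: "poly Q2 p \<noteq> 0"
      using Q2(2) by (simp add: poly_eq_0_iff_dvd)
    \<comment> \<open>This is the value of \<open>(s - p) ^ Suc m * P / Q\<close> at
      \<open>p\<close>, the one constant for which \<open>P - smult c Q2\<close> vanishes at
      \<open>p\<close>.\<close>
    define c where "c = poly P p / poly Q2 p"
    define Q1 where "Q1 = [:- p, 1:] ^ m * Q2"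
    have Q: "Q = [:- p, 1:] * Q1"
      using Q2(1) unfolding m Q1_def power_Suc mult.assoc .
    have "Q1 \<noteq> 0" "Q2 \<noteq> 0"
      using Q less.prems(1) Q2p by auto
    have degQ: "degree Q = Suc (degree Q1)"
      unfolding Q using \<open>Q1 \<noteq> 0\<close> by (subst degree_mult_eq) auto
    have "poly (P - smult c Q2) p = 0"
      using Q2p by (simp add: c_def)
    then have "[:- p, 1:] dvd P - smult c Q2"
      by (simp only: poly_eq_0_iff_dvd)
    then obtain P1 where P1: "P - smult c Q2 = [:- p, 1:] * P1"
      by (rule dvdE)
    have "degree Q1 = m + degree Q2"
      using \<open>Q2 \<noteq> 0\<close> by (simp add: Q1_def degree_mult_eq degree_linear_power)
    then have "degree (P - smult c Q2) < degree Q"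
      using less.prems False degQ
      by (intro degree_diff_less) (auto intro: le_less_trans[OF degree_smult_le])
    then have degP1: "P1 = 0 \<or> degree P1 < degree Q1"
      unfolding P1 degQ by (cases "P1 = 0") (simp_all add: degree_mult_eq del: mult_pCons_left)
    have "degree Q1 < degree Q"
      using degQ by simp
    from less.hyps[OF this \<open>Q1 \<noteq> 0\<close> degP1] obtain g where g:
      "\<And>s. (\<And>z. poly Q1 z = 0 \<Longrightarrow> Re z < Re s) \<Longrightarrow>
         set_integrable lborel {0..} (\<lambda>t. exp (- s * of_real t) * g t) \<and>
         (LINT t:{0..}|lborel. exp (- s * of_real t) * g t) = poly P1 s / poly Q1 s"
      by blast
    define h where "h t = g t + c / fact m * (of_real t ^ m * exp (p * of_real t))" for t
    show ?thesis
    proof (intro exI[of _ h] allI impI)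
      fix s
      assume s: "\<forall>z. poly Q z = 0 \<longrightarrow> Re z < Re s"
      have ps: "0 < Re (s - p)"
        using s p by simp
      have Q1s: "set_integrable lborel {0..} (\<lambda>t. exp (- s * of_real t) * g t)"
        "(LINT t:{0..}|lborel. exp (- s * of_real t) * g t) = poly P1 s / poly Q1 s"
        using g[of s] s by (simp_all add: Q)
      have e: "exp (- s * of_real t) * h t = exp (- s * of_real t) * g t
          + c / fact m * (of_real t ^ m * exp (- (s - p) * of_real t))" for t
      proof -
        have "exp (- (s - p) * of_real t) = exp (- s * of_real t) * exp (p * of_real t)"
          by (subst exp_add[symmetric]) (simp add: algebra_simps)
        then show ?thesis
          unfolding h_def by (simp only: distrib_left mult_ac)
      qed
      have i2: "set_integrable lborel {0..}
          (\<lambda>t. c / fact m * (of_real t ^ m * exp (- (s - p) * of_real t)))"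
        by (intro set_integrable_mult_right set_integrable_power_exp_complex[OF ps])
      have "(LINT t:{0..}|lborel. exp (- s * of_real t) * h t)
          = poly P1 s / poly Q1 s + c / fact m * (fact m / (s - p) ^ Suc m)"
        unfolding e set_integral_add(2)[OF Q1s(1) i2] Q1s(2) set_integral_mult_right
          set_integral_power_exp[OF ps] ..
      also have "\<dots> = poly P s / poly Q s"
      proof -
        have sp: "s - p \<noteq> 0" "poly Q2 s \<noteq> 0"
          using ps s by (auto simp: Q Q1_def)
        have "poly P s = (s - p) * poly P1 s + c * poly Q2 s"
          using arg_cong[OF P1, of "\<lambda>q. poly q s"] by (simp add: algebra_simps)
        moreover have "poly Q s = (s - p) * ((s - p) ^ m * poly Q2 s)"
          "poly Q1 s = (s - p) ^ m * poly Q2 s"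
          by (simp_all add: Q Q1_def algebra_simps)
        \<comment> \<open>Here \<open>y\<close>, \<open>w\<close>, \<open>q\<close> and
          \<open>F\<close> stand for \<open>s - p\<close>, \<open>(s - p) ^ m\<close>,
          \<open>poly Q2 s\<close> and \<open>fact m\<close>.\<close>
        moreover have "a / (w * q) + c / F * (F / (y * w)) = (y * a + c * q) / (y * (w * q))"
          if "y \<noteq> 0" "w \<noteq> 0" "q \<noteq> 0" "F \<noteq> 0" for a w q y F :: complex
        proof -
          have "a / (w * q) = y * a / (y * (w * q))" "c / F * (F / (y * w)) = c * q / (y * (w * q))"
            using that by simp_all
          then show ?thesis
            by (simp only: add_divide_distrib)
        qed
        ultimately show ?thesis
          using sp by (simp only: power_Suc fact_nonzero power_not_zero not_False_eq_True)
      qed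
      finally show "set_integrable lborel {0..} (\<lambda>t. exp (- s * of_real t) * h t) \<and>
          (LINT t:{0..}|lborel. exp (- s * of_real t) * h t) = poly P s / poly Q s"
        unfolding e using set_integral_add(1)[OF Q1s(1) i2] by simp
    qed
  qed
qed

text \<open>The half plane is determined by the poles of \<open>G\<close> itself, so for stable
  \<open>G\<close> it contains all \<open>s\<close> with nonnegative real part. Integrability is
  required separately because the integral in \<open>laplace\<close> is 0 by default when it does
  not exist.\<close>

definition has_transform :: "(real \<Rightarrow> real) \<Rightarrow> transfer_function \<Rightarrow> bool" where
  "has_transform v G \<longleftrightarrow>
     (\<forall>t<0. v t = 0) \<and>
     (\<forall>s. (\<forall>z\<in>tf_poles G. Re z < Re s) \<longrightarrow>
        set_integrable lborel {0..} (\<lambda>t. exp (- s * of_real t) * of_real (v t)) \<and>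
        laplace v s = tf_eval G s)"

lemma inverse_laplace_exists:
  assumes "tf_strictly_proper G"
  shows "\<exists>v. has_transform v G"
proof -
  have "tf_num G = 0 \<or> degree (tf_num G) < degree (tf_den G)"
    using assms by (simp add: tf_strictly_proper_def tf_num_eq_0_iff)
  from inverse_laplace_rational[OF tf_den_nonzero this] obtain g where g:
    "\<And>s. (\<And>z. z \<in> tf_poles G \<Longrightarrow> Re z < Re s) \<Longrightarrow>
       set_integrable lborel {0..} (\<lambda>t. exp (- s * of_real t) * g t) \<and>
       (LINT t:{0..}|lborel. exp (- s * of_real t) * g t) = tf_eval G s"
    unfolding tf_poles_def tf_eval_def by auto
  define v where "v t = (if t < 0 then 0 else Re (g t))" for t
  have "has_transform v G"
    unfolding has_transform_def
  proof (intro conjI allI impI)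
    fix s
    assume s: "\<forall>z\<in>tf_poles G. Re z < Re s"
    let ?f = "\<lambda>s t. indicator {0..} t *\<^sub>R (exp (- s * of_real t) * g t)"
    have gs: "integrable lborel (?f s)" "integral\<^sup>L lborel (?f s) = tf_eval G s"
      using g[of s] s by (auto simp: set_integrable_def set_lebesgue_integral_def)
    have gc: "integrable lborel (?f (cnj s))" "integral\<^sup>L lborel (?f (cnj s)) = cnj (tf_eval G s)"
      using g[of "cnj s"] s
      by (auto simp: set_integrable_def set_lebesgue_integral_def tf_eval_cnj)
    \<comment> \<open>The transform is real on the real axis, so \<open>g\<close> and its conjugate have the same transform.\<close>
    have e: "indicator {0..} t *\<^sub>R (exp (- s * of_real t) * of_real (v t))
        = (?f s t + cnj (?f (cnj s) t)) / 2" for t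
      by (auto simp: v_def indicator_def exp_cnj complex_add_cnj distrib_left[symmetric])
    have c: "integrable lborel (\<lambda>t. cnj (?f (cnj s) t))"
      using gc(1) by (rule integrable_cnj)
    show "set_integrable lborel {0..} (\<lambda>t. exp (- s * of_real t) * of_real (v t))"
      unfolding set_integrable_def e
      by (intro integrable_divide_zero Bochner_Integration.integrable_add gs(1) c)
    have "laplace v s = (tf_eval G s + cnj (integral\<^sup>L lborel (?f (cnj s)))) / 2"
      unfolding laplace_def set_lebesgue_integral_def e
      unfolding integral_divide_zero Bochner_Integration.integral_add[OF gs(1) c]
        Bochner_Integration.integral_cnj gs(2) ..
    then show "laplace v s = tf_eval G s"
      unfolding gc(2) by simp
  qed (simp add: v_def)
  then show ?thesis
    by blast
qed

section \<open>Admissible signals, the bound by the energy, and the disturbance\<close>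

lemma laplace_signalI:
  assumes "\<And>t. t < 0 \<Longrightarrow> v t = 0"
    and "set_integrable lborel {0..} (\<lambda>t. exp (- of_real \<sigma> * of_real t) * complex_of_real (v t))"
  shows "laplace_signal v"
proof -
  have "integrable lborel (\<lambda>t. complex_of_real (indicator {0..} t *\<^sub>R (exp (- \<sigma> * t) * v t)))"
    using assms(2) unfolding set_integrable_def
    by (simp add: exp_of_real[symmetric] scaleR_conv_of_real)
  then have "set_integrable lborel {0..} (\<lambda>t. exp (- \<sigma> * t) * v t)"
    unfolding set_integrable_def complex_of_real_integrable_eq .
  then show ?thesis
    using assms(1) unfolding laplace_signal_def by blast
qed

text \<open>The pointwise inequality \<open>2 * a * b \<le> a\<^sup>2 + b\<^sup>2\<close> takes the
  place of Cauchy-Schwarz. The bound is not sharp, but it depends only on \<open>Re s\<close> and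
  \<open>L2_norm v\<close>, which is enough to make it uniform in a family of signals.\<close>

lemma norm_laplace_le:
  assumes "set_integrable lborel {0..} (\<lambda>t. exp (- s * of_real t) * of_real (v t))"
    and "0 < Re s" and "bounded_norm v"
  shows "norm (laplace v s)
           \<le> ((LINT t:{0..}|lborel. exp (- (2 * Re s) * t)) + (L2_norm v)\<^sup>2) / 2"
proof -
  let ?f = "\<lambda>t. indicator {0..} t *\<^sub>R (exp (- s * of_real t) * of_real (v t))"
  let ?b = "\<lambda>t. (indicator {0..} t *\<^sub>R exp (- (2 * Re s) * t) + (v t)\<^sup>2) / 2"
  have e: "integrable lborel (\<lambda>t. indicator {0..} t *\<^sub>R exp (- (2 * Re s) * t))"
    using set_integrable_power_exp[of "2 * Re s" 0] assms(2) by (simp add: set_integrable_def)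
  have v: "integrable lborel (\<lambda>t. (v t)\<^sup>2)"
    using assms(3) by (simp add: bounded_norm_def)
  have le: "norm (?f t) \<le> ?b t" for t
  proof (cases "0 \<le> t")
    case True
    have "2 * (exp (- Re s * t) * \<bar>v t\<bar>) \<le> (exp (- Re s * t))\<^sup>2 + (v t)\<^sup>2"
      using zero_le_power2[of "exp (- Re s * t) - \<bar>v t\<bar>"] by (simp add: power2_diff)
    moreover have "(exp (- Re s * t))\<^sup>2 = exp (- (2 * Re s) * t)"
      by (simp add: exp_double[symmetric])
    ultimately show ?thesis
      using True by (simp add: norm_mult)
  qed simp
  have "norm (laplace v s) \<le> (LINT t|lborel. ?b t)"
    unfolding laplace_def set_lebesgue_integral_def
  proof (rule order_trans[OF integral_norm_bound], rule integral_mono)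
    show "integrable lborel (\<lambda>t. norm (?f t))"
      using assms(1) unfolding set_integrable_def by (rule integrable_norm)
    show "integrable lborel ?b"
      by (intro integrable_divide_zero Bochner_Integration.integrable_add e v)
  qed (rule le)
  also have "\<dots> = ((LINT t:{0..}|lborel. exp (- (2 * Re s) * t)) + (LINT t|lborel. (v t)\<^sup>2)) / 2"
    unfolding set_lebesgue_integral_def
    by (subst integral_divide_zero, subst Bochner_Integration.integral_add[OF e v]) simp
  also have "(LINT t|lborel. (v t)\<^sup>2) = (L2_norm v)\<^sup>2"
    by (simp add: L2_norm_def)
  finally show ?thesis .
qed

text \<open>This signal will be the disturbance on the leader: it has finite energy, and its
  transform has no zero that could cancel the growth of the errors.\<close>

lemma decaying_exponential:
  fixes v :: "real \<Rightarrow> real"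
  defines "v \<equiv> \<lambda>t. if t < 0 then 0 else exp (- t)"
  shows "laplace_signal v" "bounded_norm v" "\<And>s. -1 < Re s \<Longrightarrow> laplace v s = 1 / (1 + s)"
proof -
  have e: "exp (- s * of_real t) * of_real (v t) = of_real t ^ 0 * exp (- (1 + s) * of_real t)"
    if "t \<in> {0..}" for s :: complex and t
    using that by (simp add: v_def exp_of_real[symmetric] exp_add[symmetric] algebra_simps)
  have "set_integrable lborel {0..} (\<lambda>t. exp (- of_real 0 * of_real t) * complex_of_real (v t))"
    using set_integrable_power_exp_complex[of "1 + of_real 0" 0]
    by (subst set_integrable_cong[OF refl refl e]) auto
  then show "laplace_signal v"
    by (intro laplace_signalI[of v 0]) (simp_all add: v_def)
  have "integrable lborel (\<lambda>t::real. indicator {0..} t *\<^sub>R (t ^ 0 * exp (- 2 * t)))"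
    using set_integrable_power_exp[of 2 0] unfolding set_integrable_def by simp
  moreover have "indicator {0..} t *\<^sub>R (t ^ 0 * exp (- 2 * t)) = (v t)\<^sup>2" for t
    by (auto simp: v_def exp_double[symmetric])
  ultimately show "bounded_norm v"
    unfolding bounded_norm_def v_def by simp
  show "laplace v s = 1 / (1 + s)" if "-1 < Re s" for s
  proof -
    have "laplace v s = (LINT t:{0..}|lborel. of_real t ^ 0 * exp (- (1 + s) * of_real t))"
      unfolding laplace_def by (rule set_lebesgue_integral_cong) (use e in auto)
    also have "\<dots> = 1 / (1 + s)"
      using set_integral_power_exp[of "1 + s" 0] that by simp
    finally show ?thesis .
  qed
qed

text \<open>\<open>E\<close> is the transform of the decaying exponential as a transfer function.
  Being stable, it can multiply closed-loop transfer functions without spoiling their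
  stability.\<close>

lemma first_order_lag:
  fixes E :: transfer_function
  defines "E \<equiv> inverse (1 + tf_s)"
  shows "\<And>s. s \<noteq> -1 \<Longrightarrow> s \<notin> tf_poles E" "\<And>s. s \<noteq> -1 \<Longrightarrow> tf_eval E s = 1 / (1 + s)"
    "tf_stable E" "(tf_eval E \<longlongrightarrow> 0) at_infinity"
proof -
  have *: "s \<notin> tf_poles (1 + tf_s)" "tf_eval (1 + tf_s) s = 1 + s" for s
    by (simp_all add: tf_add tf_1 tf_s)
  have nz: "1 + s \<noteq> 0" if "s \<noteq> -1" for s :: complex
    using that by (metis add.inverse_inverse neg_eq_iff_add_eq_0)
  show p: "s \<notin> tf_poles E" if "s \<noteq> -1" for s
    unfolding E_def by (rule tf_inverse(1)) (simp_all add: * nz[OF that])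
  show e: "tf_eval E s = 1 / (1 + s)" if "s \<noteq> -1" for s
    unfolding E_def using tf_inverse(2)[of s "1 + tf_s"] nz[OF that] by (simp add: * divide_inverse)
  show "tf_stable E"
    unfolding tf_stable_def using p by force
  have "((\<lambda>s::complex. inverse (1 + s)) \<longlongrightarrow> 0) at_infinity"
    by (rule filterlim_compose[OF tendsto_inverse_0]
        tendsto_add_filterlim_at_infinity[OF tendsto_const filterlim_ident])+
  moreover have "\<forall>\<^sub>F s::complex in at_infinity. s \<notin> {-1}"
    by (rule eventually_at_infinity_notin_finite) simp
  then have "\<forall>\<^sub>F s in at_infinity. inverse (1 + s) = tf_eval E s"
    by eventually_elim (simp add: e divide_inverse)
  ultimately show "(tf_eval E \<longlongrightarrow> 0) at_infinity"
    by (rule Lim_transform_eventually)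
qed


subsection \<open>Amplification near the origin\<close>

lemma exists_direction:
  fixes c :: complex
  assumes "c \<noteq> 0" "2 \<le> m"
  shows "\<exists>w. 0 < Re w \<and> 0 < Re (c * w ^ m)"
proof (intro exI conjI)
  \<comment> \<open>Cancelling the whole argument of \<open>c\<close> could require the angle
    \<open>pi / 2\<close> when \<open>m = 2\<close>, which is on the imaginary axis. Cancelling
    three quarters keeps \<open>\<theta>\<close> within \<open>3 / 8 * pi\<close> and leaves the
    argument \<open>Arg c / 4\<close>, at most \<open>pi / 4\<close> in absolute value.\<close>
  define \<theta> where "\<theta> = - (3 / 4) * Arg c / m"
  have Arg: "\<bar>Arg c\<bar> \<le> pi"
    using Arg_bounded[of c] by auto
  have "\<bar>\<theta>\<bar> = 3 / 4 * \<bar>Arg c\<bar> / m"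
    by (simp add: \<theta>_def abs_mult)
  also have "\<dots> \<le> 3 / 4 * pi / 2"
    using Arg assms(2) by (intro frac_le mult_left_mono) auto
  also have "\<dots> < pi / 2"
    using pi_gt_zero by linarith
  finally show "0 < Re (cis \<theta>)"
    using cos_gt_zero_pi[of \<theta>] by auto
  have "c * cis \<theta> ^ m = of_real (cmod c) * cis (Arg c) * cis \<theta> ^ m"
    using rcis_cmod_Arg[of c] by (simp only: rcis_def)
  also have "\<dots> = of_real (cmod c) * (cis (Arg c) * cis (m * \<theta>))"
    unfolding Complex.DeMoivre mult.assoc ..
  also have "cis (Arg c) * cis (m * \<theta>) = cis (Arg c / 4)"
    using assms(2) by (simp add: cis_mult \<theta>_def field_simps)
  finally have "Re (c * cis \<theta> ^ m) = cmod c * cos (Arg c / 4)"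
    by simp
  moreover have "0 < cos (Arg c / 4)"
    using Arg pi_gt_zero by (intro cos_gt_zero_pi) linarith+
  ultimately show "0 < Re (c * cis \<theta> ^ m)"
    using assms(1) by simp
qed

text \<open>\<open>j\<close> is the order of the zero at the origin and \<open>tf_eval F 0\<close>
  the leading Taylor coefficient.\<close>

lemma tf_factor_zero_at_0:
  assumes "G \<noteq> 0" "0 \<notin> tf_poles G"
  shows "\<exists>j F. G = tf_s ^ j * F \<and> 0 \<notin> tf_poles F \<and> tf_eval F 0 \<noteq> 0"
proof -
  have at0: "poly (map_poly complex_of_real p) 0 = of_real (poly p 0)" for p
    by (simp add: poly_0_coeff_0 coeff_map_poly)
  obtain p q where G: "G = Fract p q" "poly (map_poly complex_of_real q) 0 \<noteq> 0"
    using tf_cases_at[OF assms(2)] .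
  have "p \<noteq> 0"
    using assms(1) G by (auto simp: fract_collapse)
  then obtain a where a: "p = [:- 0, 1:] ^ order 0 p * a" "\<not> [:- 0, 1:] dvd a"
    using order_decomp by blast
  define j where "j = order 0 p"
  have p: "p = [:0, 1:] ^ j * a" and a0: "poly a 0 \<noteq> 0"
    using a by (simp_all add: j_def poly_eq_0_iff_dvd)
  have "tf_s ^ j = Fract ([:0, 1:] ^ j) 1"
    by (induction j) (simp_all add: tf_s_def One_fract_def)
  then have "G = tf_s ^ j * Fract a q"
    by (simp add: G(1) p)
  moreover have "0 \<notin> tf_poles (Fract a q)" "tf_eval (Fract a q) 0 \<noteq> 0"
    using tf_Fract[OF G(2), of a] G(2) a0 by (simp_all add: at0)
  ultimately show ?thesis
    by blast
qed

lemma eventually_at_notin_finite: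
  fixes a :: "'a::t1_space"
  assumes "finite A"
  shows "\<forall>\<^sub>F x in at a within S. x \<notin> A"
proof -
  have "open (- (A - {a}))"
    using assms by (intro open_Compl finite_imp_closed finite_Diff)
  then show ?thesis
    unfolding eventually_at_topological by (intro exI[of _ "- (A - {a})"]) auto
qed

text \<open>With \<open>T = tf_s ^ j * F\<close> the function is \<open>1 - s ^ m * F\<close> for
  \<open>m = j + 2\<close>. On the ray \<open>s = t * w\<close> its real part is
  \<open>1 + t ^ m * Re (- F(s) * w ^ m)\<close>; the direction \<open>w\<close> makes the last
  factor positive at \<open>t = 0\<close>, hence also for small \<open>t > 0\<close>. The ray meets
  the finite set \<open>A\<close> only finitely often.\<close>

lemma exists_amplified_point:
  assumes T: "T \<noteq> 0" "0 \<notin> tf_poles T" and A: "finite A"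
  shows "\<exists>s. 0 < Re s \<and> s \<notin> A \<and> 1 < cmod (tf_eval (1 - tf_s\<^sup>2 * T) s)"
proof -
  obtain j F where F: "T = tf_s ^ j * F" "0 \<notin> tf_poles F" "tf_eval F 0 \<noteq> 0"
    using tf_factor_zero_at_0[OF T] by blast
  define m where "m = j + 2"
  have H: "1 - tf_s\<^sup>2 * T = 1 - tf_s ^ m * F"
    unfolding F(1) m_def by (simp add: power_add power2_eq_square mult_ac)
  obtain w where w: "0 < Re w" "0 < Re (- tf_eval F 0 * w ^ m)"
    using exists_direction[of "- tf_eval F 0" m] F(3) by (auto simp: m_def)
  have "w \<noteq> 0"
    using w(1) by auto
  have cont: "isCont (\<lambda>t. tf_eval F (of_real t * w)) (0::real)"
    by (rule isCont_o2[where g = "tf_eval F"])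
       (auto intro!: continuous_intros continuous_tf_eval F(2))
  have "isCont (\<lambda>t. Re (- tf_eval F (of_real t * w) * w ^ m)) (0::real)"
    by (intro isCont_Re continuous_intros cont)
  then have "((\<lambda>t. Re (- tf_eval F (of_real t * w) * w ^ m))
      \<longlongrightarrow> Re (- tf_eval F 0 * w ^ m)) (at_right 0)"
    unfolding isCont_def of_real_0 mult_zero_left by (rule tendsto_within_subset) simp
  from order_tendstoD(1)[OF this w(2)]
  have pos: "\<forall>\<^sub>F t in at_right 0. 0 < Re (- tf_eval F (of_real t * w) * w ^ m)" .
  have "finite ((\<lambda>t. of_real t * w) -` (A \<union> tf_poles F))"
    using A \<open>w \<noteq> 0\<close> by (intro finite_vimageI) (auto simp: finite_tf_poles inj_def)
  then have "\<forall>\<^sub>F t in at_right 0. t \<notin> (\<lambda>t. of_real t * w) -` (A \<union> tf_poles F)"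
    by (rule eventually_at_notin_finite)
  with pos eventually_at_right_less[of 0]
  have "\<forall>\<^sub>F t in at_right 0. 0 < t \<and> of_real t * w \<notin> A \<union> tf_poles F \<and>
      0 < Re (- tf_eval F (of_real t * w) * w ^ m)"
    by eventually_elim auto
  then obtain t :: real where t: "0 < t" "of_real t * w \<notin> A \<union> tf_poles F"
    "0 < Re (- tf_eval F (of_real t * w) * w ^ m)"
    using eventually_happens'[OF trivial_limit_at_right_real] by blast
  define s where "s = of_real t * w"
  have "s \<notin> tf_poles F"
    using t(2) by (simp add: s_def)
  then have "tf_eval (1 - tf_s\<^sup>2 * T) s = 1 - s ^ m * tf_eval F s"
    unfolding H by (simp add: tf_diff tf_1 tf_mult tf_power tf_s)
  also have "\<dots> = 1 + of_real (t ^ m) * (- tf_eval F s * w ^ m)"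
    by (simp add: s_def power_mult_distrib)
  finally have eq: "tf_eval (1 - tf_s\<^sup>2 * T) s = 1 + of_real (t ^ m) * (- tf_eval F s * w ^ m)" .
  have "Re (tf_eval (1 - tf_s\<^sup>2 * T) s) = 1 + t ^ m * Re (- tf_eval F s * w ^ m)"
    unfolding eq
    by (simp only: scaleR_conv_of_real[symmetric] plus_complex.sel one_complex.sel scaleR_complex.sel)
  moreover have "0 < t ^ m * Re (- tf_eval F s * w ^ m)"
    unfolding s_def using t(1,3) by (intro mult_pos_pos zero_less_power)
  ultimately have "1 < Re (tf_eval (1 - tf_s\<^sup>2 * T) s)"
    by linarith
  then have "1 < cmod (tf_eval (1 - tf_s\<^sup>2 * T) s)"
    using complex_Re_le_cmod[of "tf_eval (1 - tf_s\<^sup>2 * T) s"] by linarith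
  moreover have "0 < Re s" "s \<notin> A"
    using t w(1) by (simp_all add: s_def)
  ultimately show ?thesis
    by blast
qed

section \<open>Expansions at the origin up to a factor \<open>tf_s\<^sup>2\<close>\<close>

lemma tf_nonzero_at_0_inverse:
  assumes "tf_nonzero_at_0 G"
  shows "G \<noteq> 0" "0 \<notin> tf_poles (inverse G)"
proof -
  show "G \<noteq> 0"
    using assms tf_num_eq_0_iff[of G] by (auto simp: tf_nonzero_at_0_def)
  \<comment> \<open>\<open>G\<close> may have a pole at the origin, so the function that is regular
    there is \<open>inverse G\<close>: its denominator is the numerator of \<open>G\<close>, which
    does not vanish at 0.\<close>
  have "inverse G = Fract (snd (quot_of_fract G)) (fst (quot_of_fract G))"
    by (metis Fract_quot_of_fract inverse_fract)
  then show "0 \<notin> tf_poles (inverse G)"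
    using tf_Fract(1)[of "fst (quot_of_fract G)" 0] assms
    by (simp add: tf_nonzero_at_0_def tf_num_def)
qed

text \<open>The value at 0 is 1, so this is a unit among the functions regular at the
  origin.\<close>

lemma tf_1_plus_s_squared_mult:
  assumes "0 \<notin> tf_poles A"
  shows "1 + tf_s\<^sup>2 * A \<noteq> 0" "0 \<notin> tf_poles B \<Longrightarrow> 0 \<notin> tf_poles (B / (1 + tf_s\<^sup>2 * A))"
proof -
  have *: "0 \<notin> tf_poles (1 + tf_s\<^sup>2 * A)" "tf_eval (1 + tf_s\<^sup>2 * A) 0 = 1"
    using assms by (simp_all add: tf_add tf_1 tf_mult tf_power tf_s)
  then show "1 + tf_s\<^sup>2 * A \<noteq> 0"
    by (metis tf_0(2) zero_neq_one)
  show "0 \<notin> tf_poles B \<Longrightarrow> 0 \<notin> tf_poles (B / (1 + tf_s\<^sup>2 * A))"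
    using * by (intro tf_divide(1)) simp_all
qed

lemma tf_s_nonzero: "tf_s \<noteq> 0"
  using tf_s(2)[of 1] tf_0(2)[of 1] by auto

text \<open>Dividing by \<open>G\<close> gives \<open>1 / (1 + s\<^sup>2 / G)\<close>, and
  \<open>inverse G\<close> is regular at 0: at low frequency a sensor part follows its vehicle up to
  second order.\<close>

lemma tf_sensor_expansion:
  assumes "tf_nonzero_at_0 G"
  shows "\<exists>B. 0 \<notin> tf_poles B \<and> tf_sensor G = 1 - tf_s\<^sup>2 * B"
proof (intro exI conjI)
  let ?U = "1 + tf_s\<^sup>2 * inverse G"
  note G = tf_nonzero_at_0_inverse[OF assms]
  note U = tf_1_plus_s_squared_mult[OF G(2)]
  show "0 \<notin> tf_poles (inverse G / ?U)"
    using U(2) G(2) .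
  have GU: "tf_s\<^sup>2 + G = G * ?U"
    using G(1) by (simp add: distrib_left mult.left_commute)
  have "tf_sensor G = 1 / ?U"
    unfolding tf_sensor_def GU using G(1) by simp
  also have "\<dots> = (?U - tf_s\<^sup>2 * inverse G) / ?U"
    by simp
  also have "\<dots> = 1 - tf_s\<^sup>2 * (inverse G / ?U)"
    unfolding diff_divide_distrib using U(1) by simp
  finally show "tf_sensor G = 1 - tf_s\<^sup>2 * (inverse G / ?U)" .
qed


subsection \<open>The vehicle chain\<close>

text \<open>\<open>H\<close> is given by a product equation, so that no quotient by
  \<open>s\<^sup>2 + K * Mf\<close> appears. The statement serves two fields: complex numbers, for
  the transforms of the signals, and transfer functions with \<open>D = 1\<close>, for the stability
  assumption.\<close>

lemma chain_equations_solution: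
  fixes s :: "'a::field"
  assumes "s \<noteq> 0" "(s\<^sup>2 + K * Mf) * H = K * Mr"
  shows "chain_equations s K Mr Mf N (\<lambda>i. if i = 0 then D else 0) (\<lambda>i. H ^ i * D / s\<^sup>2)"
  unfolding chain_equations_def
proof (intro allI impI)
  fix i
  assume "i \<le> N"
  show "s\<^sup>2 * (H ^ i * D / s\<^sup>2) = control_input K Mr Mf (\<lambda>i. H ^ i * D / s\<^sup>2) i
      + (if i = 0 then D else 0)"
  proof (cases i)
    case 0
    then show ?thesis
      using assms(1) by (simp add: control_input_def)
  next
    case (Suc k)
    have "s\<^sup>2 * H = K * (Mr - Mf * H)"
      using assms(2) by (simp add: algebra_simps)
    then have "s\<^sup>2 * (H ^ Suc k * D / s\<^sup>2) = K * (Mr - Mf * H) * (H ^ k * D / s\<^sup>2)"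
      by (metis (no_types, opaque_lifting) mult.assoc mult.commute power_Suc times_divide_eq_right)
    then show ?thesis
      by (simp add: Suc control_input_def measured_error_def algebra_simps diff_divide_distrib)
  qed
qed

text \<open>In terms of the loop \<open>L = K / tf_s\<^sup>2\<close> one has
  \<open>H = L * Mr / (1 + L * Mf)\<close>, where \<open>L\<close> tends to 0 at infinity and the
  sensors have finite limits.\<close>

lemma transmission_strictly_proper:
  assumes "causal_chain K Mr Mf" "(tf_s\<^sup>2 + K * Mf) * H = K * Mr"
  shows "tf_strictly_proper H"
  unfolding tf_strictly_proper_iff_tendsto_0
proof (rule Lim_transform_eventually)
  define L where "L = K / tf_s\<^sup>2"
  have L0: "(tf_eval L \<longlongrightarrow> 0) at_infinity"
    using assms(1) by (simp add: causal_chain_def tf_strictly_proper_iff_tendsto_0 L_def)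
  obtain r f where r: "(tf_eval Mr \<longlongrightarrow> r) at_infinity" and f: "(tf_eval Mf \<longlongrightarrow> f) at_infinity"
    using assms(1) tf_proper_tendsto unfolding causal_chain_def by blast
  have U: "((\<lambda>s. 1 + tf_eval L s * tf_eval Mf s) \<longlongrightarrow> 1 + 0 * f) at_infinity"
    by (intro tendsto_intros L0 f)
  have "((\<lambda>s. tf_eval L s * tf_eval Mr s / (1 + tf_eval L s * tf_eval Mf s))
      \<longlongrightarrow> 0 * r / (1 + 0 * f)) at_infinity"
    by (intro tendsto_intros L0 r U) simp
  then show "((\<lambda>s. tf_eval L s * tf_eval Mr s / (1 + tf_eval L s * tf_eval Mf s))
      \<longlongrightarrow> 0) at_infinity"
    by simp
  have "K = L * tf_s\<^sup>2"
    using tf_s_nonzero by (simp add: L_def)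
  then have "tf_s\<^sup>2 * ((1 + L * Mf) * H) = tf_s\<^sup>2 * (L * Mr)"
    using assms(2) by (simp add: algebra_simps)
  then have eq: "(1 + L * Mf) * H = L * Mr"
    using tf_s_nonzero by simp
  have "\<forall>\<^sub>F s in at_infinity. 1 + tf_eval L s * tf_eval Mf s \<noteq> 0"
    using tendsto_imp_eventually_ne[OF U, of 0] by simp
  with eventually_not_tf_poles[of L] eventually_not_tf_poles[of Mf]
    eventually_not_tf_poles[of Mr] eventually_not_tf_poles[of H]
  show "\<forall>\<^sub>F s in at_infinity.
      tf_eval L s * tf_eval Mr s / (1 + tf_eval L s * tf_eval Mf s) = tf_eval H s"
  proof eventually_elim
    case (elim s)
    have "(1 + tf_eval L s * tf_eval Mf s) * tf_eval H s = tf_eval L s * tf_eval Mr s"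
      using arg_cong[OF eq, of "\<lambda>G. tf_eval G s"] elim by (simp add: tf_mult tf_add tf_1)
    then show ?case
      using elim(5) by (metis nonzero_mult_div_cancel_left)
  qed
qed

text \<open>Divided by \<open>K\<close>, the equation for \<open>H\<close> reads
  \<open>U * H = 1 - s\<^sup>2 * Br\<close> with \<open>U = 1 + s\<^sup>2 * (A - Bf)\<close> and
  \<open>A = inverse K\<close>. Both \<open>U\<close> and the right-hand side are 1 up to a multiple
  of \<open>s\<^sup>2\<close>, and solving \<open>H = 1 - s\<^sup>2 * T\<close> for \<open>T\<close>
  gives the witness.\<close>

lemma transmission_expansion:
  assumes "tf_nonzero_at_0 K" "tf_nonzero_at_0 Kr" "tf_nonzero_at_0 Kf"
  shows "\<exists>T. 0 \<notin> tf_poles T \<and>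
           (tf_s\<^sup>2 + K * tf_sensor Kf) * (1 - tf_s\<^sup>2 * T) = K * tf_sensor Kr"
proof -
  obtain Br where Br: "0 \<notin> tf_poles Br" "tf_sensor Kr = 1 - tf_s\<^sup>2 * Br"
    using tf_sensor_expansion[OF assms(2)] by blast
  obtain Bf where Bf: "0 \<notin> tf_poles Bf" "tf_sensor Kf = 1 - tf_s\<^sup>2 * Bf"
    using tf_sensor_expansion[OF assms(3)] by blast
  define A where "A = inverse K"
  note K = tf_nonzero_at_0_inverse[OF assms(1), folded A_def]
  define U where "U = 1 + tf_s\<^sup>2 * (A - Bf)"
  define T where "T = (A - Bf + Br) / U"
  have "0 \<notin> tf_poles (A - Bf)"
    using K(2) Bf(1) by (rule tf_diff(1))
  note U = tf_1_plus_s_squared_mult[OF this, folded U_def]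
  have "0 \<notin> tf_poles T"
    unfolding T_def using K(2) Bf(1) Br(1) by (intro U(2) tf_add(1) tf_diff(1))
  moreover have "(tf_s\<^sup>2 + K * tf_sensor Kf) * (1 - tf_s\<^sup>2 * T) = K * tf_sensor Kr"
  proof -
    have "K * A = 1"
      using K(1) by (simp add: A_def)
    have "tf_s\<^sup>2 + K * tf_sensor Kf = tf_s\<^sup>2 * (K * A) + K * tf_sensor Kf"
      unfolding \<open>K * A = 1\<close> by simp
    also have "\<dots> = K * U"
      unfolding Bf(2) U_def by (simp add: algebra_simps)
    finally have KU: "tf_s\<^sup>2 + K * tf_sensor Kf = K * U" .
    have "U * T = A - Bf + Br"
      using U(1) by (simp add: T_def)
    have "K * U * (1 - tf_s\<^sup>2 * T) = K * (U - tf_s\<^sup>2 * (U * T))"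
      by (simp add: algebra_simps)
    also have "\<dots> = K * tf_sensor Kr"
      unfolding \<open>U * T = A - Bf + Br\<close> Br(2) by (simp add: U_def algebra_simps)
    finally show ?thesis
      unfolding KU .
  qed
  ultimately show ?thesis
    by blast
qed

text \<open>In the application \<open>q / s\<^sup>2\<close> is the leader's position and the
  summands are the errors, each equal to
  \<open>(h ^ (j - 1) - h ^ j) * q / s\<^sup>2\<close>.\<close>

lemma sum_geometric_telescope:
  fixes h \<tau> q :: "'a::field"
  assumes "s \<noteq> 0" "s\<^sup>2 * \<tau> = 1 - h"
  shows "q / s\<^sup>2 - (\<Sum>j\<in>{1..i}. h ^ (j - 1) * \<tau> * q) = h ^ i * q / s\<^sup>2"
proof (induction i)
  case (Suc i)
  have \<tau>: "\<tau> = (1 - h) / s\<^sup>2"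
    using assms by (simp add: field_simps)
  have "q / s\<^sup>2 - (\<Sum>j\<in>{1..Suc i}. h ^ (j - 1) * \<tau> * q)
      = h ^ i * q / s\<^sup>2 - h ^ i * \<tau> * q"
    using Suc by (simp add: algebra_simps)
  also have "\<dots> = h ^ Suc i * q / s\<^sup>2"
    unfolding \<tau> by (simp add: algebra_simps diff_divide_distrib)
  finally show ?case .
qed simp

section \<open>Geometric growth of the errors and the failure of string stability\<close>

lemma not_L2_string_stable:
  assumes K: "tf_nonzero_at_0 K" and Kr: "tf_nonzero_at_0 Kr" and Kf: "tf_nonzero_at_0 Kf"
    and causal: "causal_chain K (tf_sensor Kr) (tf_sensor Kf)"
    and stab: "stabilizing K (tf_sensor Kr) (tf_sensor Kf)"
  shows "\<not> L2_string_stable K (tf_sensor Kr) (tf_sensor Kf)"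
proof
  define Mr Mf where "Mr = tf_sensor Kr" and "Mf = tf_sensor Kf"
  assume "L2_string_stable K (tf_sensor Kr) (tf_sensor Kf)"
  then obtain c where c: "\<And>N d x k. chain_response K Mr Mf N d x \<Longrightarrow> bounded_norm (d 0) \<Longrightarrow>
      (\<And>j. j \<noteq> 0 \<Longrightarrow> d j = (\<lambda>t. 0)) \<Longrightarrow> k \<in> {1..N} \<Longrightarrow>
      bounded_norm (error_signal x k) \<and> L2_norm (error_signal x k) \<le> c * L2_norm (d 0)"
    unfolding L2_string_stable_def Mr_def Mf_def by (metis le0)
  obtain T where T: "0 \<notin> tf_poles T" "(tf_s\<^sup>2 + K * Mf) * (1 - tf_s\<^sup>2 * T) = K * Mr"
    using transmission_expansion[OF K Kr Kf] unfolding Mr_def Mf_def by blast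
  define H where "H = 1 - tf_s\<^sup>2 * T"
  have HK: "(tf_s\<^sup>2 + K * Mf) * H = K * Mr"
    using T(2) unfolding H_def .
  have H0: "(tf_eval H \<longlongrightarrow> 0) at_infinity"
    using transmission_strictly_proper[OF causal HK[unfolded Mr_def Mf_def]]
    by (simp only: tf_strictly_proper_iff_tendsto_0)
  have "T \<noteq> 0"
  proof
    assume "T = 0"
    then have "((\<lambda>s::complex. 1 :: complex) \<longlongrightarrow> 0) at_infinity"
      using H0 by (simp add: H_def tf_1(2)[abs_def])
    then show False
      by (simp add: tendsto_const_iff trivial_limit_at_infinity)
  qed
  have T0: "(tf_eval T \<longlongrightarrow> 0) at_infinity"
  proof -
    have "((\<lambda>s. 1 - tf_eval H s) \<longlongrightarrow> 1 - 0) at_infinity"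
      by (intro tendsto_intros H0)
    moreover have "\<forall>\<^sub>F s in at_infinity. 1 - tf_eval H s = tf_eval (1 - H) s"
      using eventually_not_tf_poles[of H] by eventually_elim (simp add: tf_diff tf_1)
    ultimately have "(tf_eval (1 - H) \<longlongrightarrow> 1 - 0) at_infinity"
      by (rule Lim_transform_eventually)
    from tendsto_tf_eval_mult[OF this tendsto_tf_eval_inverse_s_squared]
    have "(tf_eval ((1 - H) * inverse (tf_s\<^sup>2)) \<longlongrightarrow> 0) at_infinity"
      by simp
    moreover have "(1 - H) * inverse (tf_s\<^sup>2) = T"
      using tf_s_nonzero by (simp add: H_def)
    ultimately show ?thesis
      by simp
  qed
  define E :: transfer_function where "E = inverse (1 + tf_s)"
  note E = first_order_lag[folded E_def]
  \<comment> \<open>The transform of error \<open>j\<close>: since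
    \<open>1 - H = tf_s\<^sup>2 * T\<close>, the double integrator has cancelled.\<close>
  define W where "W j = H ^ (j - 1) * T * E" for j
  have "tf_strictly_proper (W j)" for j
  proof -
    have "(tf_eval (H ^ n) \<longlongrightarrow> 0 ^ n) at_infinity" for n
    proof (induction n)
      case 0
      then show ?case
        by (simp add: tf_1(2)[abs_def])
    next
      case (Suc n)
      then show ?case
        using tendsto_tf_eval_mult[OF H0 Suc] by simp
    qed
    from tendsto_tf_eval_mult[OF tendsto_tf_eval_mult[OF this T0] E(4)]
    show ?thesis
      unfolding W_def tf_strictly_proper_iff_tendsto_0 by simp
  qed
  then have "\<forall>j. \<exists>v. has_transform v (W j)"
    using inverse_laplace_exists by blast
  then obtain e where e: "\<And>j. has_transform (e j) (W j)"
    by metis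
  \<comment> \<open>The uncontrolled leader obeys \<open>s\<^sup>2 * x 0 = d 0\<close>, so its
    position has the transform \<open>E / s\<^sup>2\<close>.\<close>
  have "tf_strictly_proper (E * inverse (tf_s\<^sup>2))"
    using tendsto_tf_eval_mult[OF E(4) tendsto_tf_eval_inverse_s_squared]
    by (simp add: tf_strictly_proper_iff_tendsto_0)
  then obtain x0 where x0: "has_transform x0 (E * inverse (tf_s\<^sup>2))"
    using inverse_laplace_exists by blast
  define d :: "nat \<Rightarrow> real \<Rightarrow> real" where
    "d i = (if i = 0 then \<lambda>t. if t < 0 then 0 else exp (- t) else (\<lambda>t. 0))" for i
  define x where "x i t = x0 t - (\<Sum>j\<in>{1..i}. e j t)" for i t
  have response: "chain_response K Mr Mf N d x" for N
  proof -
    \<comment> \<open>To the right of \<open>A\<close> all evaluations commute with the field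
      operations. The point 0 permits division by \<open>s\<close>; the point -1 is the pole of
      \<open>E\<close> and bounds the half plane in which the transform of the disturbance is
      known.\<close>
    define A where "A = tf_poles K \<union> tf_poles Mr \<union> tf_poles Mf \<union> tf_poles H \<union> tf_poles T
      \<union> tf_poles (E * inverse (tf_s\<^sup>2)) \<union> (\<Union>j\<in>{1..N}. tf_poles (W j)) \<union> {0, -1}"
    have "finite A"
      unfolding A_def by (auto simp: finite_tf_poles)
    define \<sigma> where "\<sigma> = Max (Re ` A)"
    have \<sigma>: "Re z < Re s" if "\<sigma> < Re s" "z \<in> A" for s z
    proof -
      have "Re z \<le> \<sigma>"
        unfolding \<sigma>_def using that(2) \<open>finite A\<close> by (intro Max_ge) auto
      with that(1) show ?thesis
        by simp
    qed
    have transform: "set_integrable lborel {0..} (\<lambda>t. exp (- s * of_real t) * of_real (x i t)) \<and>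
        laplace (x i) s = tf_eval H s ^ i * tf_eval E s / s\<^sup>2"
      if s: "\<sigma> < Re s" and i: "i \<le> N" for s i
    proof -
      have A: "s \<notin> A"
        using \<sigma>[OF s] by blast
      have "s \<noteq> 0" "s \<noteq> -1" "s \<notin> tf_poles H" "s \<notin> tf_poles T"
        using A by (auto simp: A_def)
      note E_s = E(1)[OF \<open>s \<noteq> -1\<close>]
      have x0s: "set_integrable lborel {0..} (\<lambda>t. exp (- s * of_real t) * of_real (x0 t))"
        "laplace x0 s = tf_eval E s / s\<^sup>2"
        using x0 \<sigma>[OF s] \<open>s \<noteq> 0\<close> E_s
        by (auto simp: has_transform_def A_def tf_mult tf_inverse tf_power tf_s divide_inverse)
      have es: "set_integrable lborel {0..} (\<lambda>t. exp (- s * of_real t) * of_real (e j t))"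
        "laplace (e j) s = tf_eval H s ^ (j - 1) * tf_eval T s * tf_eval E s"
        if "j \<in> {1..i}" for j
      proof -
        have "j \<in> {1..N}"
          using that i by simp
        then have "tf_poles (W j) \<subseteq> A"
          unfolding A_def by blast
        then have "\<forall>z\<in>tf_poles (W j). Re z < Re s"
          using \<sigma>[OF s] by blast
        then show "set_integrable lborel {0..} (\<lambda>t. exp (- s * of_real t) * of_real (e j t))"
          "laplace (e j) s = tf_eval H s ^ (j - 1) * tf_eval T s * tf_eval E s"
          using e[of j] E_s \<open>s \<notin> tf_poles H\<close> \<open>s \<notin> tf_poles T\<close>
          by (auto simp: has_transform_def W_def tf_mult tf_power)
      qed
      have eq: "exp (- s * of_real t) * of_real (x i t) = exp (- s * of_real t) * of_real (x0 t)
          - (\<Sum>j\<in>{1..i}. exp (- s * of_real t) * of_real (e j t))" for t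
        by (simp add: x_def right_diff_distrib sum_distrib_left)
      have sum: "set_integrable lborel {0..}
          (\<lambda>t. \<Sum>j\<in>{1..i}. exp (- s * of_real t) * of_real (e j t))"
        unfolding set_integrable_def scaleR_sum_right
        by (rule Bochner_Integration.integrable_sum) (rule es(1)[unfolded set_integrable_def])
      have sum': "(LINT t:{0..}|lborel. \<Sum>j\<in>{1..i}. exp (- s * of_real t) * of_real (e j t))
          = (\<Sum>j\<in>{1..i}. laplace (e j) s)"
        unfolding laplace_def set_lebesgue_integral_def scaleR_sum_right
        by (rule Bochner_Integration.integral_sum) (rule es(1)[unfolded set_integrable_def])
      have "laplace (x i) s = laplace x0 s - (\<Sum>j\<in>{1..i}. laplace (e j) s)"
        unfolding laplace_def[of "x i"] eq set_integral_diff(2)[OF x0s(1) sum] sum'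
        by (simp only: laplace_def)
      also have "\<dots> = tf_eval E s / s\<^sup>2
          - (\<Sum>j\<in>{1..i}. tf_eval H s ^ (j - 1) * tf_eval T s * tf_eval E s)"
        using es(2) x0s(2) by simp
      also have "\<dots> = tf_eval H s ^ i * tf_eval E s / s\<^sup>2"
        using \<open>s \<noteq> 0\<close>
      proof (rule sum_geometric_telescope)
        show "s\<^sup>2 * tf_eval T s = 1 - tf_eval H s"
          using \<open>s \<notin> tf_poles T\<close> by (simp add: H_def tf_diff tf_1 tf_mult tf_power tf_s)
      qed
      finally show ?thesis
        unfolding eq using set_integral_diff(1)[OF x0s(1) sum] by simp
    qed
    have "laplace_signal (d i)" for i
      using decaying_exponential(1)
      by (auto simp: d_def laplace_signal_def set_integrable_def)
    moreover have "laplace_signal (x i)" if "i \<le> N" for i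
    proof (rule laplace_signalI)
      show "x i t = 0" if "t < 0" for t
        using that e x0 by (simp add: x_def has_transform_def)
      show "set_integrable lborel {0..}
          (\<lambda>t. exp (- of_real (\<sigma> + 1) * of_real t) * complex_of_real (x i t))"
        using transform[of "of_real (\<sigma> + 1)" i] that by simp
    qed
    moreover have "chain_equations s (tf_eval K s) (tf_eval Mr s) (tf_eval Mf s) N
        (\<lambda>i. laplace (d i) s) (\<lambda>i. laplace (x i) s)" if s: "\<sigma> < Re s" for s
    proof -
      have "s \<notin> A"
        using \<sigma>[OF s] by blast
      then have "s \<noteq> 0" "s \<noteq> -1" "s \<notin> tf_poles K" "s \<notin> tf_poles Mr" "s \<notin> tf_poles Mf"
        "s \<notin> tf_poles H"
        by (auto simp: A_def)
      then have "(s\<^sup>2 + tf_eval K s * tf_eval Mf s) * tf_eval H s = tf_eval K s * tf_eval Mr s"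
        using arg_cong[OF HK, of "\<lambda>G. tf_eval G s"] by (simp add: tf_mult tf_add tf_power tf_s)
      from chain_equations_solution[OF \<open>s \<noteq> 0\<close> this]
      have "chain_equations s (tf_eval K s) (tf_eval Mr s) (tf_eval Mf s) N
          (\<lambda>i. if i = 0 then tf_eval E s else 0) (\<lambda>i. tf_eval H s ^ i * tf_eval E s / s\<^sup>2)" .
      moreover have "laplace (d i) s = (if i = 0 then tf_eval E s else 0)" for i
      proof -
        have "-1 < Re s"
          using \<sigma>[OF s, of "-1"] by (simp add: A_def)
        then show ?thesis
          using decaying_exponential(3)[of s] E(2)[OF \<open>s \<noteq> -1\<close>]
          by (auto simp: d_def laplace_def)
      qed
      ultimately show ?thesis
        using transform[OF s]
        by (auto simp: chain_equations_def control_input_def measured_error_def)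
    qed
    ultimately show ?thesis
      unfolding chain_response_def by blast
  qed
  have error: "error_signal x k = e k" if "1 \<le> k" for k
  proof
    fix t
    have "{1..k} = insert k {1..k - 1}"
      using that by auto
    then show "error_signal x k t = e k t"
      using that by (simp add: error_signal_def config_error_def x_def)
  qed
  have stableW: "tf_stable (W k)" if "1 \<le> k" for k
  proof -
    \<comment> \<open>Stability is used for the chain of length \<open>k\<close> with a unit
      disturbance on the leader, at the last error.\<close>
    have "chain_equations tf_s K Mr Mf k (\<lambda>i. if i = 0 then 1 else 0) (\<lambda>i. H ^ i * 1 / tf_s\<^sup>2)"
      by (rule chain_equations_solution[OF tf_s_nonzero HK])
    then have "tf_stable (config_error (\<lambda>i. H ^ i * 1 / tf_s\<^sup>2) k)"
      using stab that unfolding stabilizing_def Mr_def[symmetric] Mf_def[symmetric]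
      by (metis atLeastAtMost_iff le0 order_refl)
    moreover have "config_error (\<lambda>i. H ^ i * 1 / tf_s\<^sup>2) k = H ^ (k - 1) * T"
    proof -
      have "H ^ k = H ^ (k - 1) * H"
        using that by (simp add: power_eq_if)
      then have "config_error (\<lambda>i. H ^ i * 1 / tf_s\<^sup>2) k = H ^ (k - 1) * (1 - H) / tf_s\<^sup>2"
        by (simp add: config_error_def right_diff_distrib diff_divide_distrib)
      then show ?thesis
        using tf_s_nonzero by (simp add: H_def)
    qed
    ultimately show ?thesis
      unfolding W_def using tf_stable_mult E(3) by simp
  qed
  obtain s where s: "0 < Re s" "s \<notin> tf_poles T" "1 < cmod (tf_eval H s)"
    using exists_amplified_point[OF \<open>T \<noteq> 0\<close> T(1) finite_tf_poles[of T]] unfolding H_def by blast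
  \<comment> \<open>String stability bounds the norms of all \<open>e k\<close> by the same number,
    so this bound on their transforms at \<open>s\<close> does not depend on
    \<open>k\<close>.\<close>
  define B where "B = ((LINT t:{0..}|lborel. exp (- (2 * Re s) * t)) + (c * L2_norm (d 0))\<^sup>2) / 2"
  have le: "cmod (tf_eval H s) ^ (k - 1) * cmod (tf_eval T s * tf_eval E s) \<le> B" if k: "1 \<le> k" for k
  proof -
    have "bounded_norm (d 0)"
      using decaying_exponential(2) by (simp add: d_def)
    with k have ek: "bounded_norm (e k)" "L2_norm (e k) \<le> c * L2_norm (d 0)"
      using c[OF response[of k], of k] error[OF k] by (auto simp: d_def)
    \<comment> \<open>All poles of \<open>W k\<close> lie in the open left half plane, so the
      transform formula is valid at this particular \<open>s\<close>.\<close>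
    have "\<forall>z\<in>tf_poles (W k). Re z < Re s"
      using stableW[OF k] s(1) unfolding tf_stable_def by force
    then have "set_integrable lborel {0..} (\<lambda>t. exp (- s * of_real t) * of_real (e k t))"
      and lap: "laplace (e k) s = tf_eval (W k) s"
      using e[of k] by (auto simp: has_transform_def)
    from norm_laplace_le[OF this(1) s(1) ek(1)]
    have "cmod (laplace (e k) s)
        \<le> ((LINT t:{0..}|lborel. exp (- (2 * Re s) * t)) + (L2_norm (e k))\<^sup>2) / 2" .
    also have "\<dots> \<le> B"
      unfolding B_def using ek(2)
      by (intro divide_right_mono add_left_mono power_mono) (simp_all add: L2_norm_def)
    finally have "cmod (tf_eval (W k) s) \<le> B"
      unfolding lap .
    moreover have "tf_eval (W k) s = tf_eval H s ^ (k - 1) * (tf_eval T s * tf_eval E s)"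
    proof -
      have "s \<notin> tf_poles H"
        unfolding H_def using s(2) by (intro tf_diff(1) tf_1 tf_mult(1) tf_power(1) tf_s)
      moreover have "s \<notin> tf_poles E"
        using s(1) by (intro E(1)) auto
      ultimately show ?thesis
        using s(2) by (simp add: W_def tf_mult tf_power)
    qed
    ultimately show ?thesis
      by (simp add: norm_mult norm_power)
  qed
  define q where "q = cmod (tf_eval T s * tf_eval E s)"
  have "0 < q"
  proof -
    \<comment> \<open>A zero of \<open>T\<close> at \<open>s\<close> would give \<open>H\<close> the
      value 1 there, against its modulus being greater than 1.\<close>
    have "tf_eval H s = 1 - s\<^sup>2 * tf_eval T s"
      using s(2) by (simp add: H_def tf_diff tf_1 tf_mult tf_power tf_s)
    then have "tf_eval T s \<noteq> 0"
      using s(3) by auto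
    moreover have "s \<noteq> -1" "1 + s \<noteq> 0"
      using s(1) by (auto simp: complex_eq_iff)
    then have "tf_eval E s \<noteq> 0"
      using E(2)[of s] by simp
    ultimately show ?thesis
      by (simp add: q_def)
  qed
  obtain n where "B / q < cmod (tf_eval H s) ^ n"
    using real_arch_pow[OF s(3)] by blast
  then have "B < cmod (tf_eval H s) ^ n * q"
    using \<open>0 < q\<close> by (simp add: divide_less_eq)
  \<comment> \<open>Error \<open>k\<close> carries the power \<open>k - 1\<close> of
    \<open>H\<close>, so the power \<open>n\<close> occurs at \<open>k = Suc n\<close>.\<close>
  with le[of "Suc n"] show False
    by (simp add: q_def)
qed

text \<open>The same constant works: one error has at most the norm of the whole error vector, and
  when a single vehicle is disturbed the norm of the disturbance vector is that of its one nonzero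
  entry.\<close>

lemma L2_l2_imp_L2_string_stable:
  assumes "L2_l2_string_stable K Mr Mf"
  shows "L2_string_stable K Mr Mf"
proof -
  obtain c where c: "\<And>N d x. chain_response K Mr Mf N d x \<Longrightarrow> (\<And>i. i \<le> N \<Longrightarrow> bounded_norm (d i)) \<Longrightarrow>
      (\<forall>k\<in>{1..N}. bounded_norm (error_signal x k)) \<and>
      L2_l2_norm {1..N} (error_signal x) \<le> c * L2_l2_norm {0..N} d"
    using assms unfolding L2_l2_string_stable_def by blast
  show ?thesis
    unfolding L2_string_stable_def
  proof (intro exI[of _ c] allI impI ballI)
    fix N d x i k
    assume i: "i \<le> N" and k: "k \<in> {1..N}"
      and r: "chain_response K Mr Mf N d x \<and> bounded_norm (d i) \<and>
        (\<forall>j\<le>N. j \<noteq> i \<longrightarrow> d j = (\<lambda>t. 0))"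
    have "bounded_norm (d j)" if "j \<le> N" for j
      using r that by (cases "j = i") (auto simp: bounded_norm_def)
    with c r have b: "bounded_norm (error_signal x k)"
      and le: "L2_l2_norm {1..N} (error_signal x) \<le> c * L2_l2_norm {0..N} d"
      using k by blast+
    have "L2_norm (error_signal x k) \<le> L2_l2_norm {1..N} (error_signal x)"
      unfolding L2_norm_def L2_l2_norm_def
      using k by (intro real_sqrt_le_mono member_le_sum) auto
    also have "(\<Sum>j\<in>{0..N}. LINT t|lborel. (d j t)\<^sup>2)
        = (\<Sum>j\<in>{0..N}. if j = i then LINT t|lborel. (d i t)\<^sup>2 else 0)"
      using r by (intro sum.cong) auto
    then have "L2_l2_norm {0..N} d = L2_norm (d i)"
      unfolding L2_l2_norm_def L2_norm_def using i by simp
    with le have "L2_l2_norm {1..N} (error_signal x) \<le> c * L2_norm (d i)"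
      by simp
    finally show "bounded_norm (error_signal x k) \<and> L2_norm (error_signal x k) \<le> c * L2_norm (d i)"
      using b by simp
  qed
qed

theorem theorem5:
  shows "\<not> (\<exists>(K :: transfer_function) (Kr :: transfer_function) (Kf :: transfer_function).
              tf_nonzero_at_0 K \<and> tf_nonzero_at_0 Kr \<and> tf_nonzero_at_0 Kf \<and>
              causal_chain K (tf_sensor Kr) (tf_sensor Kf) \<and>
              stabilizing K (tf_sensor Kr) (tf_sensor Kf) \<and>
              L2_string_stable K (tf_sensor Kr) (tf_sensor Kf))
       \<and> \<not> (\<exists>(K :: transfer_function) (Kr :: transfer_function) (Kf :: transfer_function).
              tf_nonzero_at_0 K \<and> tf_nonzero_at_0 Kr \<and> tf_nonzero_at_0 Kf \<and>
              causal_chain K (tf_sensor Kr) (tf_sensor Kf) \<and>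
              stabilizing K (tf_sensor Kr) (tf_sensor Kf) \<and>
              L2_l2_string_stable K (tf_sensor Kr) (tf_sensor Kf))"
  using not_L2_string_stable L2_l2_imp_L2_string_stable by blast

end
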